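(* Let $(M,\langle\cdot,\cdot\rangle)$ be a Riemannian manifold and $\mathcal M=\mathrm{Imm}([0,1],M)$ the space of smooth immersions $[0,1]\to M$. The metric $G$ on $\mathcal M$ is the pullback of the metric $\tilde G$ on $T\mathcal M$ by the square root velocity function $R:\mathcal M\to T\mathcal M$, $R(c)=c'/\sqrt{\|c'\|}$; that is, for every $c\in\mathcal M$ and all $h,k\in T_c\mathcal M$, $$G_c(h,k)=\tilde G_{R(c)}\big(T_cR(h),T_cR(k)\big),$$ where $G$ and $\tilde G$ are given by $$G_c(h,k)=\langle h(0),k(0)\rangle+\int_0^1\Big(\langle\nabla_\ell h^N,\nabla_\ell k^N\rangle+\tfrac14\langle\nabla_\ell h^T,\nabla_\ell k^T\rangle\Big)\|c'(t)\|\,\mathrm dt,$$ $$\tilde G_w(\xi,\eta)=\langle\xi(0)_H,\eta(0)_H\rangle+\int_0^1\langle\xi(t)_V,\eta(t)_V\rangle\,\mathrm dt,\qquad w\in T\mathcal M,\ \xi,\eta\in T_wT\mathcal M.$$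
   Context: $(M,\langle\cdot,\cdot\rangle)$ is a (finite-dimensional, smooth) Riemannian manifold with norm $\|\cdot\|$ and Levi-Civita connection $\nabla$. $\mathcal M=\mathrm{Imm}([0,1],M)=\{c\in C^\infty([0,1],M): c'(t)\ne0\ \forall t\in[0,1]\}$. A tangent vector $h\in T_c\mathcal M$ is a smooth vector field along $c$, i.e. a smooth map $h:[0,1]\to TM$ with $h(t)\in T_{c(t)}M$. Elements of $T\mathcal M$ are thus smooth curves $w:[0,1]\to TM$ lying over elements of $\mathcal M$, and an element $\xi\in T_wT\mathcal M$ is a smooth map $\xi:[0,1]\to TTM$ with $\xi(t)\in T_{w(t)}TM$. For $c\in\mathcal M$ and $h\in T_c\mathcal M$: $v=c'/\|c'\|$, $\nabla_\ell h=\frac1{\|c'\|}\nabla_{c'}h$ is the covariant derivative of $h$ along $c$ with respect to arc length, $\nabla_\ell h^T=\langle\nabla_\ell h,v\rangle v$ and $\nabla_\ell h^N=\nabla_\ell h-\nabla_\ell h^T$. Horizontal and vertical projections: for $\xi\in T_{(p,u)}TM$, choose a smooth curve $t\mapsto(x(t),U(t))$ in $TM$ (so $U(t)\in T_{x(t)}M$) passing through $(p,u)$ at time $0$ with velocity $\xi$. Then $\xi_H:=x'(0)\in T_pM$ and $\xi_V:=\nabla_{x'(0)}U\in T_pM$ (the covariant derivative of $U$ along $x$ at time $0$). $T_cR(h)$ denotes the derivative of $R$ at $c$ in direction $h$: if $s\mapsto c(s,\cdot)$ is a smooth path in $\mathcal M$ with $c(0,\cdot)=c$ and $\partial_sc(0,\cdot)=h$,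 then $T_cR(h)(t)=\frac{\partial}{\partial s}\big|_{s=0}R(c(s,\cdot))(t)\in TTM$. *)

theory Defs
  imports "HOL-Analysis.Analysis"
begin

section \<open>Smooth functions between Euclidean spaces\<close>

text \<open>
  Derivatives are taken within the set. This is meant for open sets and for relatively open subsets
  of \<open>{0..1}\<close> or \<open>{-\<epsilon><..<\<epsilon>} \<times> {0..1}\<close>, where derivatives within the set are unique (one-sided
  derivatives at the boundary).
\<close>

primrec Ck_on :: "nat \<Rightarrow> 'a::euclidean_space set \<Rightarrow> ('a \<Rightarrow> 'b::real_normed_vector) \<Rightarrow> bool" where
  "Ck_on 0 S f \<longleftrightarrow> continuous_on S f"
| "Ck_on (Suc k) S f \<longleftrightarrow>
     (\<exists>f'. (\<forall>x\<in>S. (f has_derivative f' x) (at x within S)) \<and> (\<forall>v. Ck_on k S (\<lambda>x. f' x v)))"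

definition smooth_on :: "'a::euclidean_space set \<Rightarrow> ('a \<Rightarrow> 'b::real_normed_vector) \<Rightarrow> bool" where
  "smooth_on S f \<longleftrightarrow> (\<forall>k. Ck_on k S f)"


section \<open>Manifolds\<close>

text \<open>
  A manifold is given by an atlas. A chart is a pair of its domain and its coordinate map; the
  values of the coordinate map outside of the domain are irrelevant. The underlying set and the
  topology are those induced by the atlas.
\<close>

type_synonym ('a, 'e) chart = "'a set \<times> ('a \<Rightarrow> 'e)"

definition chart_inv :: "('a, 'e) chart \<Rightarrow> 'e \<Rightarrow> 'a" where
  "chart_inv ch = inv_into (fst ch) (snd ch)"

definition points :: "('a, 'e) chart set \<Rightarrow> 'a set" where
  "points A = (\<Union>ch\<in>A. fst ch)"

definition smooth_atlas :: "('a, 'e::euclidean_space) chart set \<Rightarrow> bool" where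
  "smooth_atlas A \<longleftrightarrow>
     (\<forall>ch\<in>A. inj_on (snd ch) (fst ch)) \<and>
     (\<forall>ch\<in>A. \<forall>ch'\<in>A. open (snd ch ` (fst ch \<inter> fst ch')) \<and>
        smooth_on (snd ch ` (fst ch \<inter> fst ch')) (snd ch' \<circ> chart_inv ch))"

definition atlas_topology :: "('a, 'e::euclidean_space) chart set \<Rightarrow> 'a topology" where
  "atlas_topology A =
     topology (\<lambda>W. W \<subseteq> points A \<and> (\<forall>ch\<in>A. open (snd ch ` (W \<inter> fst ch))))"

lemma openin_atlas_topology:
  assumes "smooth_atlas A"
  shows "openin (atlas_topology A) W \<longleftrightarrow>
           W \<subseteq> points A \<and> (\<forall>ch\<in>A. open (snd ch ` (W \<inter> fst ch)))"
proof -
  have "istopology (\<lambda>W. W \<subseteq> points A \<and> (\<forall>ch\<in>A. open (snd ch ` (W \<inter> fst ch))))"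
    unfolding istopology_def
  proof (intro conjI allI impI ballI)
    fix S T ch
    assume S: "S \<subseteq> points A \<and> (\<forall>ch\<in>A. open (snd ch ` (S \<inter> fst ch)))"
      and T: "T \<subseteq> points A \<and> (\<forall>ch\<in>A. open (snd ch ` (T \<inter> fst ch)))" and ch: "ch \<in> A"
    have "snd ch ` (S \<inter> T \<inter> fst ch) = snd ch ` (S \<inter> fst ch) \<inter> snd ch ` (T \<inter> fst ch)"
      using assms ch unfolding smooth_atlas_def inj_on_def by blast
    then show "open (snd ch ` (S \<inter> T \<inter> fst ch))"
      using S T ch by auto
  next
    fix K ch
    assume K: "\<forall>S\<in>K. S \<subseteq> points A \<and> (\<forall>ch\<in>A. open (snd ch ` (S \<inter> fst ch)))" and "ch \<in> A"
    have "snd ch ` (\<Union>K \<inter> fst ch) = (\<Union>S\<in>K. snd ch ` (S \<inter> fst ch))"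
      by blast
    then show "open (snd ch ` (\<Union>K \<inter> fst ch))"
      using K \<open>ch \<in> A\<close> by auto
  qed blast+
  then show ?thesis
    by (simp add: atlas_topology_def topology_inverse')
qed

definition manifold :: "('a, 'e::euclidean_space) chart set \<Rightarrow> bool" where
  "manifold A \<longleftrightarrow>
     smooth_atlas A \<and> Hausdorff_space (atlas_topology A) \<and> second_countable (atlas_topology A)"

text \<open>Smooth maps from a Euclidean set to the manifold, and from the manifold to a vector space.\<close>

definition smooth_into ::
    "('a, 'e::euclidean_space) chart set \<Rightarrow> 'b::euclidean_space set \<Rightarrow> ('b \<Rightarrow> 'a) \<Rightarrow> bool" where
  "smooth_into A S f \<longleftrightarrow> f ` S \<subseteq> points A \<and>
     (\<forall>ch\<in>A. openin (top_of_set S) {x\<in>S. f x \<in> fst ch} \<and>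
             smooth_on {x\<in>S. f x \<in> fst ch} (snd ch \<circ> f))"

definition smooth_fun ::
    "('a, 'e::euclidean_space) chart set \<Rightarrow> 'a set \<Rightarrow> ('a \<Rightarrow> 'b::real_normed_vector) \<Rightarrow> bool" where
  "smooth_fun A W f \<longleftrightarrow> (\<forall>ch\<in>A. smooth_on (snd ch ` (W \<inter> fst ch)) (f \<circ> chart_inv ch))"


section \<open>Tangent vectors\<close>

text \<open>
  Every point \<open>p\<close> gets a fixed chart \<open>chart_at A p\<close> around it, and a tangent vector at \<open>p\<close> is
  represented by its coordinates in that chart. Thus every tangent space is the vector space
  \<^typ>\<open>'e\<close>, but the identification depends on the point: the coordinates in another chart \<open>ch\<close> are
  given by \<open>mdiff A (snd ch) p\<close>.
\<close>

definition chart_at :: "('a, 'e) chart set \<Rightarrow> 'a \<Rightarrow> ('a, 'e) chart" where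
  "chart_at A p = (SOME ch. ch \<in> A \<and> p \<in> fst ch)"

definition mdiff ::
    "('a, 'e::euclidean_space) chart set \<Rightarrow> ('a \<Rightarrow> 'b::real_normed_vector) \<Rightarrow> 'a \<Rightarrow> 'e \<Rightarrow> 'b" where
  "mdiff A f p u =
     frechet_derivative (f \<circ> chart_inv (chart_at A p)) (at (snd (chart_at A p) p)) u"

definition velocity ::
    "('a, 'e::euclidean_space) chart set \<Rightarrow> real set \<Rightarrow> (real \<Rightarrow> 'a) \<Rightarrow> real \<Rightarrow> 'e" where
  "velocity A S c t = vector_derivative (snd (chart_at A (c t)) \<circ> c) (at t within S)"

text \<open>
  The tangent bundle as a manifold. Being an atlas again, it can be fed to the notions above; in
  particular the tangent vectors of the tangent bundle are elements of \<^typ>\<open>'e \<times> 'e\<close>.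
\<close>

definition tangent_chart ::
    "('a, 'e::euclidean_space) chart set \<Rightarrow> ('a, 'e) chart \<Rightarrow> ('a \<times> 'e, 'e \<times> 'e) chart" where
  "tangent_chart A ch = (fst ch \<times> UNIV, \<lambda>(p, u). (snd ch p, mdiff A (snd ch) p u))"

definition tangent_bundle ::
    "('a, 'e::euclidean_space) chart set \<Rightarrow> ('a \<times> 'e, 'e \<times> 'e) chart set" where
  "tangent_bundle A = tangent_chart A ` A"

definition smooth_field :: "('a, 'e::euclidean_space) chart set \<Rightarrow> 'a set \<Rightarrow> ('a \<Rightarrow> 'e) \<Rightarrow> bool" where
  "smooth_field A W X \<longleftrightarrow>
     (\<forall>ch\<in>A. smooth_on (snd ch ` (W \<inter> fst ch))
                (\<lambda>x. mdiff A (snd ch) (chart_inv ch x) (X (chart_inv ch x))))"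

text \<open>The local vector field on the domain of \<open>ch\<close> with constant coordinates \<open>b\<close> in \<open>ch\<close>.\<close>

definition coord_field ::
    "('a, 'e::euclidean_space) chart set \<Rightarrow> ('a, 'e) chart \<Rightarrow> 'e \<Rightarrow> 'a \<Rightarrow> 'e" where
  "coord_field A ch b p =
     frechet_derivative (snd (chart_at A p) \<circ> chart_inv ch) (at (snd ch p)) b"


section \<open>Riemannian metric, Levi-Civita connection, covariant derivative\<close>

definition riemannian_metric ::
    "('a, 'e::euclidean_space) chart set \<Rightarrow> ('a \<Rightarrow> 'e \<Rightarrow> 'e \<Rightarrow> real) \<Rightarrow> bool" where
  "riemannian_metric A g \<longleftrightarrow>
     (\<forall>p\<in>points A. bilinear (g p) \<and> (\<forall>u v. g p u v = g p v u) \<and> (\<forall>u. u \<noteq> 0 \<longrightarrow> 0 < g p u u)) \<and>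
     (\<forall>W X Y. openin (atlas_topology A) W \<and> smooth_field A W X \<and> smooth_field A W Y \<longrightarrow>
        smooth_fun A W (\<lambda>p. g p (X p) (Y p)))"

text \<open>
  \<open>D p u Y\<close> is the covariant derivative at \<open>p\<close> in direction \<open>u\<close> of a vector field \<open>Y\<close> that is
  defined and smooth near \<open>p\<close>; for other \<open>Y\<close> nothing is required.
\<close>

definition affine_connection ::
    "('a, 'e::euclidean_space) chart set \<Rightarrow> ('a \<Rightarrow> 'e \<Rightarrow> ('a \<Rightarrow> 'e) \<Rightarrow> 'e) \<Rightarrow> bool" where
  "affine_connection A D \<longleftrightarrow>
     (\<forall>W Y Z. openin (atlas_topology A) W \<and> smooth_field A W Y \<and> smooth_field A W Z \<longrightarrow>
        (\<forall>p\<in>W. linear (\<lambda>u. D p u Y)) \<and>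
        (\<forall>p\<in>W. \<forall>u. D p u (\<lambda>q. Y q + Z q) = D p u Y + D p u Z) \<and>
        (\<forall>f. smooth_fun A W f \<longrightarrow>
           (\<forall>p\<in>W. \<forall>u. D p u (\<lambda>q. f q *\<^sub>R Y q) = mdiff A f p u *\<^sub>R Y p + f p *\<^sub>R D p u Y)) \<and>
        ((\<forall>q\<in>W. Y q = Z q) \<longrightarrow> (\<forall>p\<in>W. \<forall>u. D p u Y = D p u Z)) \<and>
        smooth_field A W (\<lambda>p. D p (Y p) Z))"

definition metric_compatible ::
    "('a, 'e::euclidean_space) chart set \<Rightarrow> ('a \<Rightarrow> 'e \<Rightarrow> 'e \<Rightarrow> real) \<Rightarrow>
     ('a \<Rightarrow> 'e \<Rightarrow> ('a \<Rightarrow> 'e) \<Rightarrow> 'e) \<Rightarrow> bool" where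
  "metric_compatible A g D \<longleftrightarrow>
     (\<forall>W Y Z. openin (atlas_topology A) W \<and> smooth_field A W Y \<and> smooth_field A W Z \<longrightarrow>
        (\<forall>p\<in>W. \<forall>u. mdiff A (\<lambda>q. g q (Y q) (Z q)) p u = g p (D p u Y) (Z p) + g p (Y p) (D p u Z)))"

text \<open>The torsion condition says that \<open>\<nabla>\<^sub>X Y - \<nabla>\<^sub>Y X\<close> is the Lie bracket, as a derivation of functions.\<close>

definition torsion_free ::
    "('a, 'e::euclidean_space) chart set \<Rightarrow> ('a \<Rightarrow> 'e \<Rightarrow> ('a \<Rightarrow> 'e) \<Rightarrow> 'e) \<Rightarrow> bool" where
  "torsion_free A D \<longleftrightarrow>
     (\<forall>W X Y (f :: 'a \<Rightarrow> real).
        openin (atlas_topology A) W \<and> smooth_field A W X \<and> smooth_field A W Y \<and> smooth_fun A W f \<longrightarrow>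
        (\<forall>p\<in>W. mdiff A f p (D p (X p) Y - D p (Y p) X) =
           mdiff A (\<lambda>q. mdiff A f q (Y q)) p (X p) - mdiff A (\<lambda>q. mdiff A f q (X q)) p (Y p)))"

definition levi_civita ::
    "('a, 'e::euclidean_space) chart set \<Rightarrow> ('a \<Rightarrow> 'e \<Rightarrow> 'e \<Rightarrow> real) \<Rightarrow>
     ('a \<Rightarrow> 'e \<Rightarrow> ('a \<Rightarrow> 'e) \<Rightarrow> 'e) \<Rightarrow> bool" where
  "levi_civita A g D \<longleftrightarrow> affine_connection A D \<and> metric_compatible A g D \<and> torsion_free A D"

text \<open>
  Covariant derivative of a vector field \<open>U\<close> along a curve \<open>x\<close>: writing
  \<open>U \<tau> = (\<Sum>b. U\<^sup>b \<tau> *\<^sub>R E\<^sub>b (x \<tau>))\<close> in a coordinate frame \<open>E\<close> around \<open>x t\<close>, it is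
  \<open>\<Sum>b. (U\<^sup>b)' t *\<^sub>R E\<^sub>b (x t) + U\<^sup>b t *\<^sub>R \<nabla>\<^bsub>x' t\<^esub> E\<^sub>b\<close>.
\<close>

definition cov_deriv ::
    "('a, 'e::euclidean_space) chart set \<Rightarrow> ('a \<Rightarrow> 'e \<Rightarrow> ('a \<Rightarrow> 'e) \<Rightarrow> 'e) \<Rightarrow> real set \<Rightarrow>
     (real \<Rightarrow> 'a) \<Rightarrow> (real \<Rightarrow> 'e) \<Rightarrow> real \<Rightarrow> 'e" where
  "cov_deriv A D S x U t =
     (let ch = chart_at A (x t);
          E = coord_field A ch;
          coeff = (\<lambda>b \<tau>. mdiff A (snd ch) (x \<tau>) (U \<tau>) \<bullet> b)
      in \<Sum>b\<in>Basis. vector_derivative (coeff b) (at t within S) *\<^sub>R E b (x t)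
                   + coeff b t *\<^sub>R D (x t) (velocity A S x t) (E b))"

definition gnorm :: "('a \<Rightarrow> 'e \<Rightarrow> 'e \<Rightarrow> real) \<Rightarrow> 'a \<Rightarrow> 'e \<Rightarrow> real" where
  "gnorm g p u = sqrt (g p u u)"


section \<open>Immersed curves and their tangent vectors\<close>

text \<open>
  Curves are functions on \<^typ>\<open>real\<close> of which only the values on \<open>{0..1}\<close> matter; all derivatives in
  the curve parameter are taken within \<open>{0..1}\<close>.
\<close>

definition Imm :: "('a, 'e::euclidean_space) chart set \<Rightarrow> (real \<Rightarrow> 'a) set" where
  "Imm A = {c. smooth_into A {0..1} c \<and> (\<forall>t\<in>{0..1}. velocity A {0..1} c t \<noteq> 0)}"

definition T_Imm :: "('a, 'e::euclidean_space) chart set \<Rightarrow> (real \<Rightarrow> 'a) \<Rightarrow> (real \<Rightarrow> 'e) set" where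
  "T_Imm A c = {h. smooth_into (tangent_bundle A) {0..1} (\<lambda>t. (c t, h t))}"

definition nabla_l ::
    "('a, 'e::euclidean_space) chart set \<Rightarrow> ('a \<Rightarrow> 'e \<Rightarrow> 'e \<Rightarrow> real) \<Rightarrow>
     ('a \<Rightarrow> 'e \<Rightarrow> ('a \<Rightarrow> 'e) \<Rightarrow> 'e) \<Rightarrow> (real \<Rightarrow> 'a) \<Rightarrow> (real \<Rightarrow> 'e) \<Rightarrow> real \<Rightarrow> 'e" where
  "nabla_l A g D c h t =
     (1 / gnorm g (c t) (velocity A {0..1} c t)) *\<^sub>R cov_deriv A D {0..1} c h t"

definition unit_tangent ::
    "('a, 'e::euclidean_space) chart set \<Rightarrow> ('a \<Rightarrow> 'e \<Rightarrow> 'e \<Rightarrow> real) \<Rightarrow> (real \<Rightarrow> 'a) \<Rightarrow> real \<Rightarrow> 'e" where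
  "unit_tangent A g c t =
     (1 / gnorm g (c t) (velocity A {0..1} c t)) *\<^sub>R velocity A {0..1} c t"

definition nabla_l_T ::
    "('a, 'e::euclidean_space) chart set \<Rightarrow> ('a \<Rightarrow> 'e \<Rightarrow> 'e \<Rightarrow> real) \<Rightarrow>
     ('a \<Rightarrow> 'e \<Rightarrow> ('a \<Rightarrow> 'e) \<Rightarrow> 'e) \<Rightarrow> (real \<Rightarrow> 'a) \<Rightarrow> (real \<Rightarrow> 'e) \<Rightarrow> real \<Rightarrow> 'e" where
  "nabla_l_T A g D c h t =
     g (c t) (nabla_l A g D c h t) (unit_tangent A g c t) *\<^sub>R unit_tangent A g c t"

definition nabla_l_N ::
    "('a, 'e::euclidean_space) chart set \<Rightarrow> ('a \<Rightarrow> 'e \<Rightarrow> 'e \<Rightarrow> real) \<Rightarrow>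
     ('a \<Rightarrow> 'e \<Rightarrow> ('a \<Rightarrow> 'e) \<Rightarrow> 'e) \<Rightarrow> (real \<Rightarrow> 'a) \<Rightarrow> (real \<Rightarrow> 'e) \<Rightarrow> real \<Rightarrow> 'e" where
  "nabla_l_N A g D c h t = nabla_l A g D c h t - nabla_l_T A g D c h t"

definition G ::
    "('a, 'e::euclidean_space) chart set \<Rightarrow> ('a \<Rightarrow> 'e \<Rightarrow> 'e \<Rightarrow> real) \<Rightarrow>
     ('a \<Rightarrow> 'e \<Rightarrow> ('a \<Rightarrow> 'e) \<Rightarrow> 'e) \<Rightarrow> (real \<Rightarrow> 'a) \<Rightarrow> (real \<Rightarrow> 'e) \<Rightarrow> (real \<Rightarrow> 'e) \<Rightarrow> real" where
  "G A g D c h k = g (c 0) (h 0) (k 0) +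
     integral {0..1} (\<lambda>t.
       (g (c t) (nabla_l_N A g D c h t) (nabla_l_N A g D c k t)
        + 1/4 * g (c t) (nabla_l_T A g D c h t) (nabla_l_T A g D c k t))
       * gnorm g (c t) (velocity A {0..1} c t))"


section \<open>Horizontal and vertical parts, and the metric on the tangent bundle\<close>

definition representing_curve ::
    "('a, 'e::euclidean_space) chart set \<Rightarrow> 'a \<times> 'e \<Rightarrow> 'e \<times> 'e \<Rightarrow> real \<Rightarrow> 'a \<times> 'e" where
  "representing_curve A w \<xi> =
     (SOME \<sigma>. (\<exists>\<epsilon>>0. smooth_into (tangent_bundle A) {-\<epsilon><..<\<epsilon>} \<sigma>) \<and>
              \<sigma> 0 = w \<and> velocity (tangent_bundle A) UNIV \<sigma> 0 = \<xi>)"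

definition hor_part :: "('a, 'e::euclidean_space) chart set \<Rightarrow> 'a \<times> 'e \<Rightarrow> 'e \<times> 'e \<Rightarrow> 'e" where
  "hor_part A w \<xi> = velocity A UNIV (fst \<circ> representing_curve A w \<xi>) 0"

definition ver_part ::
    "('a, 'e::euclidean_space) chart set \<Rightarrow> ('a \<Rightarrow> 'e \<Rightarrow> ('a \<Rightarrow> 'e) \<Rightarrow> 'e) \<Rightarrow>
     'a \<times> 'e \<Rightarrow> 'e \<times> 'e \<Rightarrow> 'e" where
  "ver_part A D w \<xi> =
     cov_deriv A D UNIV (fst \<circ> representing_curve A w \<xi>) (snd \<circ> representing_curve A w \<xi>) 0"

definition G_tilde ::
    "('a, 'e::euclidean_space) chart set \<Rightarrow> ('a \<Rightarrow> 'e \<Rightarrow> 'e \<Rightarrow> real) \<Rightarrow>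
     ('a \<Rightarrow> 'e \<Rightarrow> ('a \<Rightarrow> 'e) \<Rightarrow> 'e) \<Rightarrow>
     (real \<Rightarrow> 'a \<times> 'e) \<Rightarrow> (real \<Rightarrow> 'e \<times> 'e) \<Rightarrow> (real \<Rightarrow> 'e \<times> 'e) \<Rightarrow> real" where
  "G_tilde A g D w \<xi> \<eta> =
     g (fst (w 0)) (hor_part A (w 0) (\<xi> 0)) (hor_part A (w 0) (\<eta> 0)) +
     integral {0..1} (\<lambda>t. g (fst (w t)) (ver_part A D (w t) (\<xi> t)) (ver_part A D (w t) (\<eta> t)))"


section \<open>The square root velocity function and its derivative\<close>

definition SRV ::
    "('a, 'e::euclidean_space) chart set \<Rightarrow> ('a \<Rightarrow> 'e \<Rightarrow> 'e \<Rightarrow> real) \<Rightarrow>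
     (real \<Rightarrow> 'a) \<Rightarrow> real \<Rightarrow> 'a \<times> 'e" where
  "SRV A g c =
     (\<lambda>t. (c t, (1 / sqrt (gnorm g (c t) (velocity A {0..1} c t))) *\<^sub>R velocity A {0..1} c t))"

text \<open>Smooth paths in \<^term>\<open>Imm A\<close> through \<open>c\<close> with velocity \<open>h\<close> at parameter \<open>0\<close>.\<close>

definition variation ::
    "('a, 'e::euclidean_space) chart set \<Rightarrow> (real \<Rightarrow> 'a) \<Rightarrow> (real \<Rightarrow> 'e) \<Rightarrow>
     (real \<Rightarrow> real \<Rightarrow> 'a) \<Rightarrow> bool" where
  "variation A c h \<gamma> \<longleftrightarrow>
     (\<exists>\<epsilon>>0. smooth_into A ({-\<epsilon><..<\<epsilon>} \<times> {0..1}) (\<lambda>(s, t). \<gamma> s t) \<and>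
            (\<forall>s\<in>{-\<epsilon><..<\<epsilon>}. \<gamma> s \<in> Imm A)) \<and>
     (\<forall>t\<in>{0..1}. \<gamma> 0 t = c t \<and> velocity A UNIV (\<lambda>s. \<gamma> s t) 0 = h t)"

definition T_SRV ::
    "('a, 'e::euclidean_space) chart set \<Rightarrow> ('a \<Rightarrow> 'e \<Rightarrow> 'e \<Rightarrow> real) \<Rightarrow>
     (real \<Rightarrow> 'a) \<Rightarrow> (real \<Rightarrow> 'e) \<Rightarrow> real \<Rightarrow> 'e \<times> 'e" where
  "T_SRV A g c h t =
     (let \<gamma> = (SOME \<gamma>. variation A c h \<gamma>)
      in velocity (tangent_bundle A) UNIV (\<lambda>s. SRV A g (\<gamma> s) t) 0)"

end

theory Submission
  imports Defs
begin

text \<open>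
  Let \<open>\<gamma>\<close> be a variation of \<open>c\<close> in direction \<open>h\<close>. The vertical part of \<open>T\<^sub>cR(h)\<close> is the covariant
  derivative in \<open>s\<close> of \<open>\<parallel>\<partial>\<^sub>t\<gamma>\<parallel>\<close> to the power \<open>-1/2\<close> times \<open>\<partial>\<^sub>t\<gamma>\<close>. Since \<open>\<nabla>\<^sub>s \<partial>\<^sub>t\<gamma> = \<nabla>\<^sub>t \<partial>\<^sub>s\<gamma> = \<nabla>\<^sub>t h\<close>
  and the connection is metric, it equals the square root of \<open>\<parallel>c'\<parallel>\<close> times
  \<open>\<nabla>\<^sub>\<ell> h - 1/2 \<langle>\<nabla>\<^sub>\<ell> h, v\<rangle> v\<close>, that is, times the sum of the normal part of \<open>\<nabla>\<^sub>\<ell> h\<close> and half its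
  tangential part; so the integrands agree pointwise. The horizontal part is \<open>h\<close>.

  As \<open>T\<^sub>cR\<close> is defined by means of some variation, one must exist. Without an exponential map it is
  obtained by a partition of unity of \<open>[0, 1]\<close> into pieces that \<open>c\<close> maps into charts, adding the
  corresponding parts of \<open>s * h\<close> in coordinates one after the other.
\<close>

section \<open>Calculus of smooth functions\<close>

text \<open>A tangent vector is stored in a chart \<open>chart_at A p\<close> that jumps with the
  point, so a field along a curve cannot be differentiated as it stands. Every computation at a time
  t therefore uses the one chart fixed for \<open>c t\<close>: at \<open>c t\<close> stored vectors
  and coordinates coincide, and elsewhere \<open>mdiff\<close> and \<open>coord_field\<close>
  translate. The constant 1/4 stems from the exponent -1/2: differentiating that power of the norm
  removes half of the tangential component and leaves the normal one alone; the two are orthogonal,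
  so the half enters squared. The factor that is the square root of the speed, also squared, is the
  arc length density. \<open>T_SRV\<close> and \<open>representing_curve\<close> are choices, so
  only their defining properties can be used, and these must be shown satisfiable. The t-interval is
  closed, so derivatives are one-sided at its ends; their uniqueness and the symmetry of second
  derivatives are proved relative to a set. Adding coordinates makes sense in one chart only. The
  pieces can be added successively because every deformation starts at \<open>c\<close> for s = 0,
  where the velocities simply add up.\<close>

lemma Ck_on_cong:
  assumes "Ck_on k S f" "\<And>x. x \<in> S \<Longrightarrow> f x = g x"
  shows "Ck_on k S g"
proof (cases k)
  case 0
  then show ?thesis using assms continuous_on_cong[of S S f g] by auto
next
  case (Suc n)
  then show ?thesis using assms unfolding Suc Ck_on.simps
    by (metis has_derivative_transform)
qed

lemma Ck_on_subset: "Ck_on k S f \<Longrightarrow> T \<subseteq> S \<Longrightarrow> Ck_on k T f"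
proof (induction k arbitrary: f)
  case 0
  then show ?case by (auto intro: continuous_on_subset)
next
  case (Suc k)
  then show ?case unfolding Ck_on.simps by (meson has_derivative_subset subsetD)
qed

lemma Ck_on_imp_continuous_on: "Ck_on k S f \<Longrightarrow> continuous_on S f"
  by (cases k) (auto intro: has_derivative_continuous_on)

lemma Ck_on_SucD: "Ck_on (Suc k) S f \<Longrightarrow> Ck_on k S f"
proof (induction k arbitrary: f)
  case 0
  then show ?case using Ck_on_imp_continuous_on by (simp del: Ck_on.simps add: Ck_on.simps(1)) blast
next
  case (Suc k)
  then show ?case by (metis Ck_on.simps(2))
qed

lemma Ck_on_const: "Ck_on k S (\<lambda>x. a)"
proof (induction k arbitrary: a)
  case (Suc k)
  then show ?case
    unfolding Ck_on.simps by (intro exI[of _ "\<lambda>x v. 0"]) auto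
qed auto

lemma Ck_on_bounded_linear:
  assumes "bounded_linear L"
  shows "Ck_on k S f \<Longrightarrow> Ck_on k S (\<lambda>x. L (f x))"
proof (induction k arbitrary: f)
  case 0
  then show ?case using assms by (auto intro: bounded_linear.continuous_on)
next
  case (Suc k)
  then obtain f' where f': "\<forall>x\<in>S. (f has_derivative f' x) (at x within S)"
      "\<forall>v. Ck_on k S (\<lambda>x. f' x v)"
    by auto
  show ?case unfolding Ck_on.simps
    using f' Suc.IH assms
    by (intro exI[of _ "\<lambda>x v. L (f' x v)"]) (auto intro: bounded_linear.has_derivative)
qed

lemma Ck_on_add:
  shows "Ck_on k S f \<Longrightarrow> Ck_on k S g \<Longrightarrow> Ck_on k S (\<lambda>x. f x + g x)"
proof (induction k arbitrary: f g)
  case 0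
  then show ?case by (auto intro: continuous_intros)
next
  case (Suc k)
  then obtain f' g' where f': "\<forall>x\<in>S. (f has_derivative f' x) (at x within S)"
      "\<forall>v. Ck_on k S (\<lambda>x. f' x v)"
    and g': "\<forall>x\<in>S. (g has_derivative g' x) (at x within S)" "\<forall>v. Ck_on k S (\<lambda>x. g' x v)"
    by auto
  show ?case unfolding Ck_on.simps
    using f' g' Suc.IH
    by (intro exI[of _ "\<lambda>x v. f' x v + g' x v"]) (auto intro: has_derivative_add)
qed

lemma Ck_on_sum: "(\<And>i. i \<in> I \<Longrightarrow> Ck_on k S (f i)) \<Longrightarrow> Ck_on k S (\<lambda>x. \<Sum>i\<in>I. f i x)"
  by (induction I rule: infinite_finite_induct) (auto intro: Ck_on_const Ck_on_add)

lemma Ck_on_bounded_bilinear: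
  assumes "bounded_bilinear B"
  shows "Ck_on k S f \<Longrightarrow> Ck_on k S g \<Longrightarrow> Ck_on k S (\<lambda>x. B (f x) (g x))"
proof (induction k arbitrary: f g)
  case 0
  then show ?case using assms by (auto intro: bounded_bilinear.continuous_on)
next
  case (Suc k)
  then obtain f' g' where f': "\<forall>x\<in>S. (f has_derivative f' x) (at x within S)"
      "\<forall>v. Ck_on k S (\<lambda>x. f' x v)"
    and g': "\<forall>x\<in>S. (g has_derivative g' x) (at x within S)" "\<forall>v. Ck_on k S (\<lambda>x. g' x v)"
    by auto
  show ?case unfolding Ck_on.simps
    using f' g' Suc.IH Ck_on_SucD[OF Suc.prems(1)] Ck_on_SucD[OF Suc.prems(2)]
    by (intro exI[of _ "\<lambda>x v. B (f x) (g' x v) + B (f' x v) (g x)"])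
       (auto intro!: Ck_on_add bounded_bilinear.FDERIV[OF assms])
qed

lemma Ck_on_ident: "Ck_on k S (\<lambda>x. x)"
  by (cases k) (auto intro!: exI[of _ "\<lambda>x v. v"] Ck_on_const)

lemma Ck_on_Pair:
  "Ck_on k S f \<Longrightarrow> Ck_on k S g \<Longrightarrow> Ck_on k S (\<lambda>x. (f x, g x))"
proof (induction k arbitrary: f g)
  case 0
  then show ?case by (auto intro: continuous_intros)
next
  case (Suc k)
  then obtain f' g' where f': "\<forall>x\<in>S. (f has_derivative f' x) (at x within S)"
      "\<forall>v. Ck_on k S (\<lambda>x. f' x v)"
    and g': "\<forall>x\<in>S. (g has_derivative g' x) (at x within S)" "\<forall>v. Ck_on k S (\<lambda>x. g' x v)"
    by auto
  show ?case unfolding Ck_on.simps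
    using f' g' Suc.IH
    by (intro exI[of _ "\<lambda>x v. (f' x v, g' x v)"]) (auto intro: has_derivative_Pair)
qed

text \<open>In the chain rule both the base point and the direction fed to \<open>g'\<close> vary
  with x. Expanding the direction in the basis leaves sums of products of a scalar function of class
  k and a composition with a partial derivative of \<open>g\<close>, to which the induction
  hypothesis applies.\<close>

lemma Ck_on_compose:
  fixes f :: "'a::euclidean_space \<Rightarrow> 'b::euclidean_space" and g :: "'b \<Rightarrow> 'c::real_normed_vector"
  assumes "f ` S \<subseteq> T"
  shows "Ck_on k S f \<Longrightarrow> Ck_on k T g \<Longrightarrow> Ck_on k S (\<lambda>x. g (f x))"
proof (induction k arbitrary: g)
  case 0
  then show ?case using assms by (auto intro: continuous_on_compose2)
next
  case (Suc k)
  then obtain f' g' where f': "\<forall>x\<in>S. (f has_derivative f' x) (at x within S)"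
      "\<forall>v. Ck_on k S (\<lambda>x. f' x v)"
    and g': "\<forall>x\<in>T. (g has_derivative g' x) (at x within T)" "\<forall>v. Ck_on k T (\<lambda>x. g' x v)"
    by auto
  have lin: "g' y u = (\<Sum>b\<in>Basis. (u \<bullet> b) *\<^sub>R g' y b)" if "y \<in> T" for y u
  proof -
    have "linear (g' y)"
      using g'(1) that by (blast intro: has_derivative_linear)
    then have "g' y (\<Sum>b\<in>Basis. (u \<bullet> b) *\<^sub>R b) = (\<Sum>b\<in>Basis. (u \<bullet> b) *\<^sub>R g' y b)"
      by (simp add: linear_sum linear_cmul)
    then show ?thesis by (simp add: euclidean_representation)
  qed
  show ?case unfolding Ck_on.simps
  proof (intro exI[of _ "\<lambda>x v. g' (f x) (f' x v)"] conjI ballI allI)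
    fix x assume "x \<in> S"
    then have "(g has_derivative g' (f x)) (at (f x) within f ` S)"
      using assms g'(1) has_derivative_subset by blast
    with \<open>x \<in> S\<close> f'(1) show "((\<lambda>x. g (f x)) has_derivative (\<lambda>v. g' (f x) (f' x v))) (at x within S)"
      by (blast intro: has_derivative_in_compose)
  next
    fix v
    have "Ck_on k S (\<lambda>x. g' (f x) b)" for b
      using Suc.IH[of "\<lambda>x. g' x b"] Ck_on_SucD[OF Suc.prems(1)] g'(2) by simp
    then have "Ck_on k S (\<lambda>x. \<Sum>b\<in>Basis. (f' x v \<bullet> b) *\<^sub>R g' (f x) b)"
      using f'(2)
      by (intro Ck_on_sum Ck_on_bounded_bilinear[OF bounded_bilinear_scaleR]
          Ck_on_bounded_linear[OF bounded_linear_inner_left]) auto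
    then show "Ck_on k S (\<lambda>x. g' (f x) (f' x v))"
      by (rule Ck_on_cong) (metis assms image_subset_iff lin)
  qed
qed

text \<open>The derivative is a product of copies of the function itself, which closes the
  induction.\<close>

lemma Ck_on_inverse: "Ck_on k (- {0}) (inverse :: real \<Rightarrow> real)"
proof (induction k)
  case 0
  then show ?case by (auto intro: continuous_intros)
next
  case (Suc k)
  have "Ck_on k (- {0}) (\<lambda>x::real. - 1 * (inverse x * v * inverse x))" for v
    using Suc by (intro Ck_on_bounded_bilinear[OF bounded_bilinear_mult] Ck_on_const)
  then show ?case unfolding Ck_on.simps
    by (intro exI[of _ "\<lambda>x v. - (inverse x * v * inverse x)"] conjI ballI allI has_derivative_inverse') auto
qed

section \<open>Closure properties of smooth functions\<close>

lemma smooth_onI: "(\<And>k. Ck_on k S f) \<Longrightarrow> smooth_on S f"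
  and smooth_onD: "smooth_on S f \<Longrightarrow> Ck_on k S f"
  by (simp_all add: smooth_on_def)

lemma smooth_on_cong: "smooth_on S f \<Longrightarrow> (\<And>x. x \<in> S \<Longrightarrow> f x = g x) \<Longrightarrow> smooth_on S g"
  unfolding smooth_on_def using Ck_on_cong by blast

lemma smooth_on_subset: "smooth_on S f \<Longrightarrow> T \<subseteq> S \<Longrightarrow> smooth_on T f"
  unfolding smooth_on_def using Ck_on_subset by blast

lemma smooth_on_imp_continuous_on: "smooth_on S f \<Longrightarrow> continuous_on S f"
  unfolding smooth_on_def using Ck_on_imp_continuous_on by blast

lemma smooth_on_const: "smooth_on S (\<lambda>x. a)"
  and smooth_on_ident: "smooth_on S (\<lambda>x. x)"
  by (simp_all add: smooth_on_def Ck_on_const Ck_on_ident)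

lemma smooth_on_bounded_linear: "bounded_linear L \<Longrightarrow> smooth_on S f \<Longrightarrow> smooth_on S (\<lambda>x. L (f x))"
  by (simp add: smooth_on_def Ck_on_bounded_linear)

lemma smooth_on_add: "smooth_on S f \<Longrightarrow> smooth_on S g \<Longrightarrow> smooth_on S (\<lambda>x. f x + g x)"
  by (simp add: smooth_on_def Ck_on_add)

lemma smooth_on_sum: "(\<And>i. i \<in> I \<Longrightarrow> smooth_on S (f i)) \<Longrightarrow> smooth_on S (\<lambda>x. \<Sum>i\<in>I. f i x)"
  by (simp add: smooth_on_def Ck_on_sum)

lemma smooth_on_bounded_bilinear:
  "bounded_bilinear B \<Longrightarrow> smooth_on S f \<Longrightarrow> smooth_on S g \<Longrightarrow> smooth_on S (\<lambda>x. B (f x) (g x))"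
  by (simp add: smooth_on_def Ck_on_bounded_bilinear)

lemmas smooth_on_mult = smooth_on_bounded_bilinear[OF bounded_bilinear_mult]
lemmas smooth_on_scaleR = smooth_on_bounded_bilinear[OF bounded_bilinear_scaleR]
lemmas smooth_on_inner = smooth_on_bounded_linear[OF bounded_linear_inner_left]
lemmas smooth_on_fst = smooth_on_bounded_linear[OF bounded_linear_fst]
lemmas smooth_on_snd = smooth_on_bounded_linear[OF bounded_linear_snd]

lemma smooth_on_Pair: "smooth_on S f \<Longrightarrow> smooth_on S g \<Longrightarrow> smooth_on S (\<lambda>x. (f x, g x))"
  by (simp add: smooth_on_def Ck_on_Pair)

lemma smooth_on_compose:
  fixes f :: "'a::euclidean_space \<Rightarrow> 'b::euclidean_space"
  shows "smooth_on S f \<Longrightarrow> smooth_on T g \<Longrightarrow> f ` S \<subseteq> T \<Longrightarrow> smooth_on S (\<lambda>x. g (f x))"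
  unfolding smooth_on_def using Ck_on_compose by blast

text \<open>\<open>smooth_on\<close> provides a separate derivative for each order k. On an open set
  uniqueness identifies all of them with \<open>frechet_derivative\<close>, which is therefore
  smooth to every order.\<close>

lemma smooth_on_derivative:
  assumes "smooth_on S f" "open S"
  shows "x \<in> S \<Longrightarrow> f differentiable (at x)"
    and "smooth_on S (\<lambda>x. frechet_derivative f (at x) v)"
proof -
  have D: "\<exists>f'. (\<forall>x\<in>S. (f has_derivative f' x) (at x)) \<and> (\<forall>v. Ck_on k S (\<lambda>x. f' x v))" for k
    using smooth_onD[OF assms(1), of "Suc k"] assms(2) by (simp add: at_within_open[OF _ assms(2)])
  show "x \<in> S \<Longrightarrow> f differentiable (at x)"
    using D[of 0] differentiable_def by blast
  show "smooth_on S (\<lambda>x. frechet_derivative f (at x) v)"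
  proof (rule smooth_onI)
    fix k
    obtain f' where f': "\<forall>x\<in>S. (f has_derivative f' x) (at x)" "\<forall>v. Ck_on k S (\<lambda>x. f' x v)"
      using D by blast
    then show "Ck_on k S (\<lambda>x. frechet_derivative f (at x) v)"
      using frechet_derivative_at by (fastforce intro: Ck_on_cong)
  qed
qed

text \<open>A sufficient condition for derivatives within a set to be unique.\<close>

definition fat :: "'a::euclidean_space set \<Rightarrow> bool" where
  "fat S \<longleftrightarrow> (\<forall>x\<in>S. \<forall>i\<in>Basis. \<forall>e>0. \<exists>d. 0 < \<bar>d\<bar> \<and> \<bar>d\<bar> < e \<and> x + d *\<^sub>R i \<in> S)"

lemma fat_UNIV: "fat UNIV"
  unfolding fat_def using dense abs_of_pos by (metis UNIV_I)

lemma fat_openin: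
  assumes "fat S" "openin (top_of_set S) T"
  shows "fat T"
  unfolding fat_def
proof (intro ballI allI impI)
  fix x i :: 'a and e :: real assume x: "x \<in> T" "i \<in> Basis" "e > 0"
  obtain U where U: "open U" "T = S \<inter> U"
    using assms(2) by (auto simp: openin_open)
  then obtain r where r: "r > 0" "ball x r \<subseteq> U"
    using x openE by blast
  obtain d where d: "0 < \<bar>d\<bar>" "\<bar>d\<bar> < min e r" "x + d *\<^sub>R i \<in> S"
    using assms(1) x U r unfolding fat_def by (metis IntD1 min_less_iff_conj)
  then have "x + d *\<^sub>R i \<in> ball x r"
    using x by (simp add: dist_norm)
  with d r U show "\<exists>d. 0 < \<bar>d\<bar> \<and> \<bar>d\<bar> < e \<and> x + d *\<^sub>R i \<in> T"
    by auto
qed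

lemma fat_open: "open S \<Longrightarrow> fat S"
  using fat_openin[OF fat_UNIV] by auto

lemma fat_interval:
  assumes "a < (b::real)"
  shows "fat {a..b}"
  unfolding fat_def
proof (intro ballI allI impI)
  fix x i e :: real assume "x \<in> {a..b}" "i \<in> Basis" "e > 0"
  then have x: "a \<le> x" "x \<le> b" "i = 1" "e > 0" by auto
  show "\<exists>d. 0 < \<bar>d\<bar> \<and> \<bar>d\<bar> < e \<and> x + d *\<^sub>R i \<in> {a..b}"
  proof (cases "x < b")
    case True
    with x show ?thesis by (intro exI[of _ "min (e/2) (b - x)"]) auto
  next
    case False
    with x assms show ?thesis by (intro exI[of _ "- min (e/2) (b - a)"]) auto
  qed
qed

lemma fat_Times:
  assumes "fat S" "fat T"
  shows "fat (S \<times> T)"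
  unfolding fat_def Basis_prod_def
proof (safe)
  fix a b and i :: 'a and e :: real assume "a \<in> S" "b \<in> T" "e > 0" "i \<in> Basis"
  then show "\<exists>d. 0 < \<bar>d\<bar> \<and> \<bar>d\<bar> < e \<and> (a, b) + d *\<^sub>R (i, 0) \<in> S \<times> T"
    using assms(1) by (auto simp: fat_def)
next
  fix a b and i :: 'b and e :: real assume "a \<in> S" "b \<in> T" "e > 0" "i \<in> Basis"
  then show "\<exists>d. 0 < \<bar>d\<bar> \<and> \<bar>d\<bar> < e \<and> (a, b) + d *\<^sub>R (0, i) \<in> S \<times> T"
    using assms(2) by (auto simp: fat_def)
qed

text \<open>Derivatives found on relatively open pieces can thus be read as derivatives within
  \<open>S\<close>, including one-sided ones.\<close>

lemma at_within_openin:
  assumes "openin (top_of_set S) T" "x \<in> T"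
  shows "at x within T = at x within S"
proof -
  obtain U where "open U" "T = S \<inter> U"
    using assms by (auto simp: openin_open)
  with assms(2) show ?thesis
    by (intro at_within_nhd[of x U]) auto
qed

text \<open>Uniqueness replaces the existential witness by one canonical derivative; this is what
  allows local information to be glued.\<close>

lemma Ck_on_Suc_fat:
  assumes "fat S"
  shows "Ck_on (Suc k) S f \<longleftrightarrow> (\<forall>x\<in>S. f differentiable (at x within S)) \<and>
           (\<forall>v. Ck_on k S (\<lambda>x. frechet_derivative f (at x within S) v))"
proof
  assume "Ck_on (Suc k) S f"
  then obtain f' where f': "\<forall>x\<in>S. (f has_derivative f' x) (at x within S)"
      "\<forall>v. Ck_on k S (\<lambda>x. f' x v)"
    by auto
  then have diff: "\<forall>x\<in>S. f differentiable (at x within S)"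
    by (auto simp: differentiable_def)
  have "f' x = frechet_derivative f (at x within S)" if "x \<in> S" for x
    using assms f'(1) diff that unfolding fat_def
    by (intro frechet_derivative_unique_within[of f _ x S]) (auto simp: frechet_derivative_works)
  then have "\<forall>v. Ck_on k S (\<lambda>x. frechet_derivative f (at x within S) v)"
    using f'(2) Ck_on_cong by fastforce
  with diff show "(\<forall>x\<in>S. f differentiable (at x within S)) \<and>
           (\<forall>v. Ck_on k S (\<lambda>x. frechet_derivative f (at x within S) v))" ..
next
  assume "(\<forall>x\<in>S. f differentiable (at x within S)) \<and>
           (\<forall>v. Ck_on k S (\<lambda>x. frechet_derivative f (at x within S) v))"
  then show "Ck_on (Suc k) S f"
    unfolding Ck_on.simps frechet_derivative_works
    by (intro exI[of _ "\<lambda>x. frechet_derivative f (at x within S)"])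
qed

text \<open>The derivatives on the pieces are restrictions of the single
  \<open>frechet_derivative\<close> within \<open>S\<close>, because a relatively open piece has the
  same filter at its points. So they fit together and the induction applies to each directional
  derivative.\<close>

lemma Ck_on_local:
  assumes "fat S"
  shows "(\<And>x. x \<in> S \<Longrightarrow> \<exists>T. openin (top_of_set S) T \<and> x \<in> T \<and> Ck_on k T f) \<Longrightarrow> Ck_on k S f"
proof (induction k arbitrary: f)
  case 0
  have "continuous (at x within S) f" if x: "x \<in> S" for x
  proof -
    obtain T where "openin (top_of_set S) T" "x \<in> T" "continuous_on T f"
      using "0"[OF x] unfolding Ck_on.simps by blast
    then show ?thesis
      by (metis at_within_openin continuous_on_eq_continuous_within)
  qed
  then show ?case by (simp add: continuous_on_eq_continuous_within)
next
  case (Suc k)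
  have D: "\<exists>T. openin (top_of_set S) T \<and> x \<in> T \<and> f differentiable (at x within S) \<and>
      (\<forall>v. Ck_on k T (\<lambda>x. frechet_derivative f (at x within S) v))" if x: "x \<in> S" for x
  proof -
    obtain T where T: "openin (top_of_set S) T" "x \<in> T" "Ck_on (Suc k) T f"
      using Suc.prems[OF x] by blast
    then have "f differentiable (at x within T)"
        "\<forall>v. Ck_on k T (\<lambda>x. frechet_derivative f (at x within T) v)"
      using Ck_on_Suc_fat[OF fat_openin[OF assms T(1)]] by auto
    moreover have "at y within T = at y within S" if "y \<in> T" for y
      using at_within_openin T(1) that by blast
    ultimately have "f differentiable (at x within S)"
        "Ck_on k T (\<lambda>x. frechet_derivative f (at x within S) v)" for v
      using T(2) Ck_on_cong[of k T "\<lambda>x. frechet_derivative f (at x within T) v"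
        "\<lambda>x. frechet_derivative f (at x within S) v"] by auto
    then show ?thesis
      using T(1,2) by blast
  qed
  show ?case
    unfolding Ck_on_Suc_fat[OF assms]
  proof (intro conjI ballI allI)
    show "Ck_on k S (\<lambda>x. frechet_derivative f (at x within S) v)" for v
      by (rule Suc.IH) (use D in blast)
  qed (use D in blast)
qed

lemma smooth_on_local:
  assumes "fat S" "\<And>x. x \<in> S \<Longrightarrow> \<exists>T. openin (top_of_set S) T \<and> x \<in> T \<and> smooth_on T f"
  shows "smooth_on S f"
proof (intro smooth_onI Ck_on_local[OF assms(1)])
  fix k x assume "x \<in> S"
  then show "\<exists>T. openin (top_of_set S) T \<and> x \<in> T \<and> Ck_on k T f"
    using assms(2)[of x] smooth_onD by blast
qed

section \<open>A smooth function that vanishes on a half-line\<close>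

text \<open>The powers of \<open>inverse x\<close> are included to make the family closed under
  differentiation up to linear combinations, also at 0.\<close>

lemma bump_has_real_derivative:
  fixes x :: real
  defines "f \<equiv> \<lambda>n x::real. if 0 < x then exp (- inverse x) * inverse x ^ n else 0"
  shows "(f n has_real_derivative (f (n + 2) x - real n * f (n + 1) x)) (at x)"
proof -
  consider "x > 0" | "x < 0" | "x = 0" by linarith
  then show ?thesis
  proof cases
    case 1
    have "((\<lambda>x. exp (- inverse x) * inverse x ^ n) has_real_derivative
            (f (n + 2) x - real n * f (n + 1) x)) (at x)"
      using 1 by (auto intro!: derivative_eq_intros simp: f_def field_simps power2_eq_square)
         (cases n; simp add: field_simps)
    then show ?thesis
      by (rule has_field_derivative_transform_within_open[where S = "{0<..}"])
         (use 1 in \<open>auto simp: f_def\<close>)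
  next
    case 2
    have "((\<lambda>x. 0) has_real_derivative (f (n + 2) x - real n * f (n + 1) x)) (at x)"
      using 2 by (simp add: f_def)
    then show ?thesis
      by (rule has_field_derivative_transform_within_open[where S = "{..<0}"])
         (use 2 in \<open>auto simp: f_def\<close>)
  next
    case 3
    \<comment> \<open>This is the difference quotient at 0, as \<open>f n 0 = 0\<close>. From the
      right, substituting the reciprocal turns it into \<open>exp (- y) * y ^ Suc n\<close> for y
      tending to infinity.\<close>
    have "((\<lambda>y::real. f n y / y) \<longlongrightarrow> 0) (at 0)"
    proof (rule filterlim_split_at)
      have "eventually (\<lambda>y::real. 0 = f n y / y) (at_left 0)"
        unfolding f_def eventually_at_left_field by (intro exI[of _ "-1"]) auto
      then show "((\<lambda>y. f n y / y) \<longlongrightarrow> 0) (at_left 0)"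
        by (rule Lim_transform_eventually[OF tendsto_const])
      have "((\<lambda>y::real. exp (- y) * y ^ Suc n) \<longlongrightarrow> 0) at_top"
        using tendsto_power_div_exp_0[of "Suc n"]
        by (simp add: exp_minus divide_inverse mult.commute)
      then have "((\<lambda>y::real. exp (- inverse y) * inverse y ^ Suc n) \<longlongrightarrow> 0) (at_right 0)"
        using filterlim_compose filterlim_inverse_at_top_right by blast
      moreover have "eventually (\<lambda>y::real. exp (- inverse y) * inverse y ^ Suc n = f n y / y) (at_right 0)"
        unfolding f_def eventually_at_right_field
        by (intro exI[of _ 1]) (auto simp: field_simps)
      ultimately show "((\<lambda>y. f n y / y) \<longlongrightarrow> 0) (at_right 0)"
        by (rule Lim_transform_eventually)
    qed
    then show ?thesis
      using 3 by (simp add: has_field_derivative_iff f_def)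
  qed
qed

text \<open>The induction on the order treats all members of the family at once; the function in
  question is the member n = 0.\<close>

lemma smooth_on_bump:
  "smooth_on UNIV (\<lambda>x::real. if 0 < x then exp (- inverse x) else 0)"
proof -
  define f where "f = (\<lambda>n x::real. if 0 < x then exp (- inverse x) * inverse x ^ n else 0)"
  have "Ck_on k UNIV (f n)" for k n
  proof (induction k arbitrary: n)
    case 0
    have "isCont (f n) x" for x
      using bump_has_real_derivative[of n x] unfolding f_def by (rule DERIV_isCont)
    then show ?case
      by (simp add: continuous_on_eq_continuous_at)
  next
    case (Suc k)
    have "Ck_on k UNIV (\<lambda>x. v * (f (n + 2) x + - real n * f (n + 1) x))" for v
      by (intro Ck_on_bounded_bilinear[OF bounded_bilinear_mult] Ck_on_add Ck_on_const Suc)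
    then have C: "Ck_on k UNIV (\<lambda>x. (f (n + 2) x - real n * f (n + 1) x) * v)" for v
      by (rule Ck_on_cong) (simp add: algebra_simps)
    have "(f n has_derivative (\<lambda>v. (f (n + 2) x - real n * f (n + 1) x) * v)) (at x)" for x
      using bump_has_real_derivative[of n x] unfolding f_def has_field_derivative_def .
    with C show ?case
      unfolding Ck_on.simps
      by (intro exI[of _ "\<lambda>x v. (f (n + 2) x - real n * f (n + 1) x) * v"] conjI ballI allI)
  qed
  from smooth_onI[OF this[of _ 0]] show ?thesis
    unfolding f_def power_0 mult_1_right .
qed

section \<open>Equality of mixed partial derivatives\<close>

text \<open>The mean value theorem is applied twice to the second difference over the rectangle:
  first in s to \<open>F s d - F s c\<close>, then in t to \<open>Fs s\<close>. Derivatives within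
  the closed intervals suffice, so a side of the rectangle may lie on the boundary of the
  domain.\<close>

lemma mixed_partials_mean_value:
  fixes F :: "real \<Rightarrow> real \<Rightarrow> real"
  assumes "a < b" "c < d"
    and Fs: "\<And>s t. s \<in> {a..b} \<Longrightarrow> t \<in> {c..d} \<Longrightarrow>
      ((\<lambda>s. F s t) has_real_derivative Fs s t) (at s within {a..b})"
    and Fst: "\<And>s t. s \<in> {a..b} \<Longrightarrow> t \<in> {c..d} \<Longrightarrow>
      ((\<lambda>t. Fs s t) has_real_derivative Fst s t) (at t within {c..d})"
  shows "\<exists>s\<in>{a..b}. \<exists>t\<in>{c..d}. F b d - F a d - (F b c - F a c) = Fst s t * (b - a) * (d - c)"
proof -
  have "\<exists>s\<in>{a<..<b}. (F b d - F b c) - (F a d - F a c) = (Fs s d - Fs s c) * (b - a)"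
    by (rule mvt_simple[OF \<open>a < b\<close>, of "\<lambda>s. F s d - F s c"],
        unfold has_field_derivative_def[symmetric], intro derivative_intros Fs) (use assms in auto)
  then obtain s where s: "s \<in> {a<..<b}" "(F b d - F b c) - (F a d - F a c) = (Fs s d - Fs s c) * (b - a)"
    by blast
  then have "\<exists>t\<in>{c<..<d}. Fs s d - Fs s c = Fst s t * (d - c)"
    by (intro mvt_simple[OF \<open>c < d\<close>, of "Fs s"], unfold has_field_derivative_def[symmetric]) (use Fst in auto)
  then obtain t where t: "t \<in> {c<..<d}" "Fs s d - Fs s c = Fst s t * (d - c)"
    by blast
  have "F b d - F a d - (F b c - F a c) = Fst s t * (b - a) * (d - c)"
    using s(2) t(2) by (simp add: algebra_simps)
  with s(1) t(1) show ?thesis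
    by (meson greaterThanLessThan_subseteq_atLeastAtMost_iff order_refl subsetD)
qed

text \<open>The second difference is symmetric in the two variables, so the mean value theorem can
  be used in either order. The two resulting points may differ; continuity brings them together
  later.\<close>

lemma mixed_partials_coincide:
  fixes F :: "real \<Rightarrow> real \<Rightarrow> real"
  assumes "a < b" "c < d"
    and Fs: "\<And>s t. s \<in> {a..b} \<Longrightarrow> t \<in> {c..d} \<Longrightarrow>
      ((\<lambda>s. F s t) has_real_derivative Fs s t) (at s within {a..b})"
    and Fst: "\<And>s t. s \<in> {a..b} \<Longrightarrow> t \<in> {c..d} \<Longrightarrow>
      ((\<lambda>t. Fs s t) has_real_derivative Fst s t) (at t within {c..d})"
    and Ft: "\<And>s t. s \<in> {a..b} \<Longrightarrow> t \<in> {c..d} \<Longrightarrow>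
      ((\<lambda>t. F s t) has_real_derivative Ft s t) (at t within {c..d})"
    and Fts: "\<And>s t. s \<in> {a..b} \<Longrightarrow> t \<in> {c..d} \<Longrightarrow>
      ((\<lambda>s. Ft s t) has_real_derivative Fts s t) (at s within {a..b})"
  shows "\<exists>p\<in>{a..b} \<times> {c..d}. \<exists>q\<in>{a..b} \<times> {c..d}. (case p of (s, t) \<Rightarrow> Fst s t) = (case q of (s, t) \<Rightarrow> Fts s t)"
proof -
  obtain s t where st: "s \<in> {a..b}" "t \<in> {c..d}"
      "F b d - F a d - (F b c - F a c) = Fst s t * (b - a) * (d - c)"
    using mixed_partials_mean_value[OF assms(1-4)] by blast
  obtain t' s' where st': "s' \<in> {a..b}" "t' \<in> {c..d}"
      "F b d - F b c - (F a d - F a c) = Fts s' t' * (d - c) * (b - a)"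
    using mixed_partials_mean_value[of c d a b "\<lambda>t s. F s t" "\<lambda>t s. Ft s t" "\<lambda>t s. Fts s t"]
      assms(1,2) Ft Fts by blast
  have "Fst s t * ((b - a) * (d - c)) = Fts s' t' * ((b - a) * (d - c))"
    using st(3) st'(3) by (simp add: algebra_simps)
  then have "Fst s t = Fts s' t'"
    using assms(1,2) by simp
  with st st' show ?thesis by force
qed

text \<open>The point \<open>t\<^sub>0\<close> may be an end point of \<open>{c..d}\<close>; then the derivatives in \<open>t\<close> are one-sided.\<close>

lemma mixed_partials_eq:
  fixes F :: "real \<times> real \<Rightarrow> 'b::euclidean_space"
  assumes O: "openin (top_of_set (S \<times> {c..d})) O'" and "open S" "c < d" "(s0, t0) \<in> O'"
    and F: "\<And>p. p \<in> O' \<Longrightarrow> (F has_derivative F' p) (at p within O')"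
    and Fs: "\<And>p. p \<in> O' \<Longrightarrow> ((\<lambda>p. F' p (1, 0)) has_derivative Fs' p) (at p within O')"
    and Ft: "\<And>p. p \<in> O' \<Longrightarrow> ((\<lambda>p. F' p (0, 1)) has_derivative Ft' p) (at p within O')"
    and cont: "continuous_on O' (\<lambda>p. Fs' p (0, 1))" "continuous_on O' (\<lambda>p. Ft' p (1, 0))"
  shows "Fs' (s0, t0) (0, 1) = Ft' (s0, t0) (1, 0)"
proof (rule euclidean_eqI)
  \<comment> \<open>The mean value theorem needs real values, hence the passage to
    components.\<close>
  fix i :: 'b assume "i \<in> Basis"
  define u v where "u p = Fs' p (0, 1) \<bullet> i" and "v p = Ft' p (1, 0) \<bullet> i" for p
  have uv: "continuous_on O' u" "continuous_on O' v"
    unfolding u_def v_def by (auto intro!: continuous_intros cont)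
  have "\<bar>u (s0, t0) - v (s0, t0)\<bar> < e" if "e > 0" for e
  proof -
    obtain d1 where d1: "d1 > 0" "\<And>p. p \<in> O' \<Longrightarrow> dist p (s0, t0) < d1 \<Longrightarrow> dist (u p) (u (s0, t0)) < e/2"
      using uv(1) \<open>e > 0\<close> assms(4) unfolding continuous_on_iff by (meson half_gt_zero)
    obtain d2 where d2: "d2 > 0" "\<And>p. p \<in> O' \<Longrightarrow> dist p (s0, t0) < d2 \<Longrightarrow> dist (v p) (v (s0, t0)) < e/2"
      using uv(2) \<open>e > 0\<close> assms(4) unfolding continuous_on_iff by (meson half_gt_zero)
    obtain d3 where d3: "d3 > 0" "ball (s0, t0) d3 \<inter> S \<times> {c..d} \<subseteq> O'"
      using O assms(4) unfolding openin_contains_ball by blast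
    have st0: "s0 \<in> S" "t0 \<in> {c..d}"
      using O assms(4) openin_imp_subset by blast+
    then obtain d4 where d4: "d4 > 0" "ball s0 d4 \<subseteq> S"
      using \<open>open S\<close> openE by blast
    \<comment> \<open>Points of the square of side r constructed next have distance at most 2 * r
      from \<open>(s0, t0)\<close>; a quarter of the minimum keeps this below all radii and leaves
      room inside \<open>{c..d}\<close>.\<close>
    define r where "r = Min {d1, d2, d3, d4, d - c} / 4"
    have r: "r > 0" "4 * r \<le> d1" "4 * r \<le> d2" "4 * r \<le> d3" "4 * r \<le> d4" "4 * r \<le> d - c"
      using d1(1) d2(1) d3(1) d4(1) \<open>c < d\<close> unfolding r_def by auto
    \<comment> \<open>The square extends to the right of \<open>t0\<close> if it fits, otherwise to
      the left; in both cases it contains \<open>t0\<close> and stays in \<open>{c..d}\<close>, even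
      if \<open>t0\<close> is an end point.\<close>
    define c' where "c' = (if t0 + r \<le> d then t0 else t0 - r)"
    have c': "c' \<in> {c..d}" "c' + r \<in> {c..d}" "\<bar>c' - t0\<bar> \<le> r" "\<bar>c' + r - t0\<bar> \<le> r"
      using st0 r unfolding c'_def by auto
    let ?R = "{s0..s0 + r} \<times> {c'..c' + r}"
    have near: "p \<in> O' \<and> dist p (s0, t0) < d1 \<and> dist p (s0, t0) < d2" if "p \<in> ?R" for p
    proof -
      have "dist p (s0, t0) \<le> \<bar>fst p - s0\<bar> + \<bar>snd p - t0\<bar>"
        using sqrt_sum_squares_le_sum_abs by (auto simp: dist_prod_def dist_real_def case_prod_unfold)
      also have "\<dots> \<le> 2 * r"
        using that c' by auto
      finally have *: "dist p (s0, t0) \<le> 2 * r" .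
      then have "p \<in> ball (s0, t0) d3"
        using r by (simp add: dist_commute)
      moreover have "fst p \<in> S"
        using that r d4(2) by (intro subsetD[OF d4(2)]) (auto simp: dist_real_def)
      moreover have "snd p \<in> {c..d}"
        using that c' by auto
      ultimately have "p \<in> O'"
        using d3(2) by (auto simp: mem_Times_iff)
      with * r show ?thesis by auto
    qed
    have slice_s: "((\<lambda>s. H (s, t) \<bullet> i) has_real_derivative H' (s, t) (1, 0) \<bullet> i) (at s within {s0..s0 + r})"
      if "\<And>p. p \<in> O' \<Longrightarrow> (H has_derivative H' p) (at p within O')" "s \<in> {s0..s0 + r}" "t \<in> {c'..c' + r}"
      for H :: "real \<times> real \<Rightarrow> 'b" and H' s t
    proof -
      have "(H has_derivative H' (s, t)) (at (s, t) within (\<lambda>s. (s, t)) ` {s0..s0 + r})"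
        by (rule has_derivative_subset[OF that(1)]) (use that near in auto)
      moreover have "((\<lambda>s. (s, t)) has_derivative (\<lambda>x. (x, 0))) (at s within {s0..s0 + r})"
        by (intro has_derivative_Pair has_derivative_ident has_derivative_const)
      ultimately have "((\<lambda>s. H (s, t)) has_derivative (\<lambda>x. H' (s, t) (x, 0))) (at s within {s0..s0 + r})"
        by (rule has_derivative_in_compose[rotated])
      then have "((\<lambda>s. H (s, t) \<bullet> i) has_derivative (\<lambda>x. H' (s, t) (x, 0) \<bullet> i)) (at s within {s0..s0 + r})"
        by (rule has_derivative_inner_left)
      moreover have "H' (s, t) (x, 0) = x *\<^sub>R H' (s, t) (1, 0)" for x
        using linear_cmul[OF has_derivative_linear[OF that(1)], of "(s, t)" x "(1, 0)"] near[of "(s, t)"] that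
        by auto
      ultimately show ?thesis
        unfolding has_field_derivative_def
        by (metis (no_types, lifting) ext inner_scaleR_left mult.commute)
    qed
    have slice_t: "((\<lambda>t. H (s, t) \<bullet> i) has_real_derivative H' (s, t) (0, 1) \<bullet> i) (at t within {c'..c' + r})"
      if "\<And>p. p \<in> O' \<Longrightarrow> (H has_derivative H' p) (at p within O')" "s \<in> {s0..s0 + r}" "t \<in> {c'..c' + r}"
      for H :: "real \<times> real \<Rightarrow> 'b" and H' s t
    proof -
      have "(H has_derivative H' (s, t)) (at (s, t) within (\<lambda>t. (s, t)) ` {c'..c' + r})"
        by (rule has_derivative_subset[OF that(1)]) (use that near in auto)
      moreover have "((\<lambda>t. (s, t)) has_derivative (\<lambda>x. (0, x))) (at t within {c'..c' + r})"
        by (intro has_derivative_Pair has_derivative_ident has_derivative_const)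
      ultimately have "((\<lambda>t. H (s, t)) has_derivative (\<lambda>x. H' (s, t) (0, x))) (at t within {c'..c' + r})"
        by (rule has_derivative_in_compose[rotated])
      then have "((\<lambda>t. H (s, t) \<bullet> i) has_derivative (\<lambda>x. H' (s, t) (0, x) \<bullet> i)) (at t within {c'..c' + r})"
        by (rule has_derivative_inner_left)
      moreover have "H' (s, t) (0, x) = x *\<^sub>R H' (s, t) (0, 1)" for x
        using linear_cmul[OF has_derivative_linear[OF that(1)], of "(s, t)" x "(0, 1)"] near[of "(s, t)"] that
        by auto
      ultimately show ?thesis
        unfolding has_field_derivative_def
        by (metis (no_types, lifting) ext inner_scaleR_left mult.commute)
    qed
    have "\<exists>p\<in>?R. \<exists>q\<in>?R. (case p of (s, t) \<Rightarrow> u (s, t)) = (case q of (s, t) \<Rightarrow> v (s, t))"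
      unfolding u_def v_def
      using slice_s[OF F] slice_t[OF Fs] slice_t[OF F] slice_s[OF Ft] \<open>r > 0\<close>
      by (intro mixed_partials_coincide[where F = "\<lambda>s t. F (s, t) \<bullet> i" and Fs = "\<lambda>s t. F' (s, t) (1, 0) \<bullet> i"
           and Ft = "\<lambda>s t. F' (s, t) (0, 1) \<bullet> i"]) auto
    then obtain p q where pq: "p \<in> ?R" "q \<in> ?R" "u p = v q"
      by auto
    have "dist (u p) (u (s0, t0)) < e/2" "dist (v q) (v (s0, t0)) < e/2"
      using d1(2) d2(2) near pq by blast+
    with pq(3) show ?thesis
      unfolding dist_real_def by linarith
  qed
  then have "u (s0, t0) = v (s0, t0)"
    by (metis abs_zero eq_iff_diff_eq_0 less_irrefl zero_less_abs_iff)
  then show "Fs' (s0, t0) (0, 1) \<bullet> i = Ft' (s0, t0) (1, 0) \<bullet> i"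
    by (simp add: u_def v_def)
qed

section \<open>Changes of charts\<close>

text \<open>The Jacobian of a change of charts. \<open>mdiff\<close> of a chart and
  \<open>coord_field\<close> are the instances with \<open>chart_at A p\<close> as source and as
  target, so all their identities reduce to those of \<open>chart_diff\<close>.\<close>

definition chart_diff ::
    "('a, 'e::euclidean_space) chart \<Rightarrow> ('a, 'e) chart \<Rightarrow> 'a \<Rightarrow> 'e \<Rightarrow> 'e" where
  "chart_diff ch ch' p = frechet_derivative (snd ch' \<circ> chart_inv ch) (at (snd ch p))"

lemma eventually_in_openin:
  assumes "openin (top_of_set S) T" "t \<in> T"
  shows "eventually (\<lambda>x. x \<in> T) (at t within S)"
proof -
  obtain U where "open U" "T = S \<inter> U"
    using assms(1) by (auto simp: openin_open)
  with assms(2) show ?thesis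
    by (auto simp: eventually_at_topological)
qed

lemma fat_at_within_neq_bot:
  fixes S :: "real set"
  assumes "fat S" "t \<in> S"
  shows "at t within S \<noteq> bot"
  unfolding trivial_limit_within islimpt_approachable_real
proof (clarify, goal_cases)
  case 1
  have "\<exists>x'\<in>S. x' \<noteq> t \<and> \<bar>x' - t\<bar> < e" if "e > 0" for e
  proof -
    obtain d where "0 < \<bar>d\<bar>" "\<bar>d\<bar> < e" "t + d *\<^sub>R 1 \<in> S"
      using assms \<open>e > 0\<close> unfolding fat_def by (metis Basis_real_def singletonI)
    then show ?thesis by (intro bexI[of _ "t + d"]) auto
  qed
  with 1 show ?case by blast
qed

text \<open>A locale, so that the results on charts, velocities and curves can be interpreted a
  second time for \<open>tangent_bundle A\<close>.\<close>

locale smooth_manifold =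
  fixes A :: "('a, 'e::euclidean_space) chart set"
  assumes smooth_atlas: "smooth_atlas A"
begin

lemma inj_on_chart: "ch \<in> A \<Longrightarrow> inj_on (snd ch) (fst ch)"
  using smooth_atlas by (simp add: smooth_atlas_def)

lemma chart_inv_chart: "ch \<in> A \<Longrightarrow> p \<in> fst ch \<Longrightarrow> chart_inv ch (snd ch p) = p"
  by (simp add: chart_inv_def inj_on_chart)

lemma chart_inv_in: "x \<in> snd ch ` fst ch \<Longrightarrow> chart_inv ch x \<in> fst ch"
  by (simp add: chart_inv_def inv_into_into)

lemma chart_chart_inv: "x \<in> snd ch ` fst ch \<Longrightarrow> snd ch (chart_inv ch x) = x"
  by (simp add: chart_inv_def f_inv_into_f)

lemma open_overlap: "ch \<in> A \<Longrightarrow> ch' \<in> A \<Longrightarrow> open (snd ch ` (fst ch \<inter> fst ch'))"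
  and smooth_transition:
    "ch \<in> A \<Longrightarrow> ch' \<in> A \<Longrightarrow> smooth_on (snd ch ` (fst ch \<inter> fst ch')) (snd ch' \<circ> chart_inv ch)"
  using smooth_atlas by (auto simp: smooth_atlas_def)

lemma open_chart_image: "ch \<in> A \<Longrightarrow> open (snd ch ` fst ch)"
  using open_overlap[of ch ch] by simp

lemma mem_overlap_iff:
  "ch \<in> A \<Longrightarrow> x \<in> snd ch ` (fst ch \<inter> fst ch') \<longleftrightarrow> x \<in> snd ch ` fst ch \<and> chart_inv ch x \<in> fst ch'"
  using chart_inv_chart by fastforce

lemma chart_at_in: "p \<in> points A \<Longrightarrow> chart_at A p \<in> A"
  and mem_chart_at: "p \<in> points A \<Longrightarrow> p \<in> fst (chart_at A p)"
proof -
  assume "p \<in> points A"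
  then have "\<exists>ch. ch \<in> A \<and> p \<in> fst ch" by (auto simp: points_def)
  then show "chart_at A p \<in> A" "p \<in> fst (chart_at A p)"
    unfolding chart_at_def by (metis (mono_tags, lifting) someI_ex)+
qed

lemma in_points: "ch \<in> A \<Longrightarrow> p \<in> fst ch \<Longrightarrow> p \<in> points A"
  by (auto simp: points_def)

lemma chart_diff_works:
  assumes "ch \<in> A" "ch' \<in> A" "p \<in> fst ch" "p \<in> fst ch'"
  shows "(snd ch' \<circ> chart_inv ch has_derivative chart_diff ch ch' p) (at (snd ch p))"
  unfolding chart_diff_def frechet_derivative_works[symmetric]
  by (rule smooth_on_derivative(1)[OF smooth_transition open_overlap]) (use assms in auto)

lemma linear_chart_diff:
  assumes "ch \<in> A" "ch' \<in> A" "p \<in> fst ch" "p \<in> fst ch'"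
  shows "linear (chart_diff ch ch' p)"
  using chart_diff_works[OF assms] by (rule has_derivative_linear)

lemma smooth_chart_diff:
  assumes "ch \<in> A" "ch' \<in> A"
  shows "smooth_on (snd ch ` (fst ch \<inter> fst ch')) (\<lambda>x. chart_diff ch ch' (chart_inv ch x) v)"
  by (rule smooth_on_cong[OF smooth_on_derivative(2)[OF smooth_transition[OF assms] open_overlap[OF assms]]])
     (use assms in \<open>auto simp: chart_diff_def chart_inv_chart\<close>)

text \<open>The chain rule for transition maps, whose composition law holds on the open overlap of
  the first two charts. This cocycle rule underlies every translation between \<open>mdiff\<close>
  and \<open>coord_field\<close>.\<close>

lemma chart_diff_comp:
  assumes "ch \<in> A" "ch' \<in> A" "ch'' \<in> A" "p \<in> fst ch" "p \<in> fst ch'" "p \<in> fst ch''"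
  shows "chart_diff ch' ch'' p (chart_diff ch ch' p u) = chart_diff ch ch'' p u"
proof -
  have "(snd ch'' \<circ> chart_inv ch' has_derivative chart_diff ch' ch'' p)
         (at ((snd ch' \<circ> chart_inv ch) (snd ch p)))"
    using chart_diff_works[of ch' ch'' p] assms by (simp add: chart_inv_chart)
  with chart_diff_works[of ch ch' p]
  have "((snd ch'' \<circ> chart_inv ch') \<circ> (snd ch' \<circ> chart_inv ch) has_derivative
          chart_diff ch' ch'' p \<circ> chart_diff ch ch' p) (at (snd ch p))"
    using assms by (intro diff_chain_at)
  then have "(snd ch'' \<circ> chart_inv ch has_derivative chart_diff ch' ch'' p \<circ> chart_diff ch ch' p)
      (at (snd ch p))"
    by (rule has_derivative_transform_within_open[OF _ open_overlap[OF assms(1,2)]])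
       (use assms in \<open>auto simp: chart_inv_chart\<close>)
  with chart_diff_works[of ch ch'' p] assms
  have "chart_diff ch' ch'' p \<circ> chart_diff ch ch' p = chart_diff ch ch'' p"
    by (meson has_derivative_unique)
  then show ?thesis by (metis comp_apply)
qed

lemma chart_diff_self:
  assumes "ch \<in> A" "p \<in> fst ch"
  shows "chart_diff ch ch p u = u"
proof -
  have "(snd ch \<circ> chart_inv ch has_derivative (\<lambda>u. u)) (at (snd ch p))"
    by (rule has_derivative_transform_within_open[OF has_derivative_ident open_chart_image[OF assms(1)]])
       (use assms in \<open>auto simp: chart_inv_chart\<close>)
  with chart_diff_works[of ch ch p] assms show ?thesis
    by (metis has_derivative_unique)
qed

lemma mdiff_chart: "mdiff A (snd ch) p = chart_diff (chart_at A p) ch p"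
  by (rule ext) (simp add: mdiff_def chart_diff_def)

lemma coord_field_eq: "coord_field A ch b p = chart_diff ch (chart_at A p) p b"
  by (simp add: coord_field_def chart_diff_def)

lemma mdiff_coord_field:
  assumes "ch \<in> A" "ch' \<in> A" "p \<in> fst ch" "p \<in> fst ch'"
  shows "mdiff A (snd ch') p (coord_field A ch b p) = chart_diff ch ch' p b"
  using assms chart_at_in mem_chart_at in_points by (simp add: mdiff_chart coord_field_eq chart_diff_comp)

lemma mdiff_coord_field_same:
  assumes "ch \<in> A" "p \<in> fst ch"
  shows "mdiff A (snd ch) p (coord_field A ch b p) = b"
  using assms by (simp add: mdiff_coord_field chart_diff_self)

lemma coord_field_mdiff:
  assumes "ch \<in> A" "p \<in> fst ch"
  shows "coord_field A ch (mdiff A (snd ch) p u) p = u"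
  using assms chart_at_in mem_chart_at in_points[OF assms]
  by (simp add: coord_field_eq mdiff_chart chart_diff_comp chart_diff_self)

lemma linear_mdiff_chart:
  assumes "ch \<in> A" "p \<in> fst ch"
  shows "linear (mdiff A (snd ch) p)"
  unfolding mdiff_chart using assms chart_at_in mem_chart_at in_points linear_chart_diff by blast

lemma linear_coord_field:
  assumes "ch \<in> A" "p \<in> fst ch"
  shows "linear (\<lambda>b. coord_field A ch b p)"
  unfolding coord_field_eq using assms chart_at_in mem_chart_at in_points linear_chart_diff by blast

text \<open>In the chart fixed for \<open>p\<close> the translation at \<open>p\<close> is the
  identity; choosing that chart makes the conversions disappear at the point of interest.\<close>

lemma coord_field_center: "p \<in> points A \<Longrightarrow> coord_field A (chart_at A p) b p = b"
  by (simp add: coord_field_eq chart_diff_self chart_at_in mem_chart_at)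

lemma mdiff_center: "p \<in> points A \<Longrightarrow> mdiff A (snd (chart_at A p)) p u = u"
  by (simp add: mdiff_chart chart_diff_self chart_at_in mem_chart_at)

section \<open>Velocities and smooth maps in arbitrary charts\<close>

text \<open>\<open>velocity\<close> is measured in \<open>chart_at A (c t)\<close>, while
  derivatives may be known in another chart. The chain rule for the transition map links them; the
  eventuality assumption ensures that the composite really is \<open>snd ch' \<circ> c\<close> near
  t.\<close>

lemma curve_change_chart:
  assumes "ch \<in> A" "ch' \<in> A" "c t \<in> fst ch" "c t \<in> fst ch'"
    and "t \<in> S" and ev: "eventually (\<lambda>\<tau>. c \<tau> \<in> fst ch) (at t within S)"
    and der: "(snd ch \<circ> c has_vector_derivative w) (at t within S)"
  shows "(snd ch' \<circ> c has_vector_derivative chart_diff ch ch' (c t) w) (at t within S)"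
proof -
  have "((snd ch' \<circ> chart_inv ch) \<circ> (snd ch \<circ> c) has_vector_derivative chart_diff ch ch' (c t) w)
      (at t within S)"
    by (rule vector_derivative_diff_chain_within[OF der])
       (use has_derivative_at_withinI[OF chart_diff_works[OF assms(1-4)]] in \<open>simp only: comp_def\<close>)
  then show ?thesis
    unfolding has_vector_derivative_def
  proof (rule has_derivative_transform_eventually[where f = "snd ch' \<circ> chart_inv ch \<circ> (snd ch \<circ> c)"])
    show "eventually (\<lambda>x. (snd ch' \<circ> chart_inv ch \<circ> (snd ch \<circ> c)) x = (snd ch' \<circ> c) x) (at t within S)"
      using ev by eventually_elim (simp add: assms chart_inv_chart)
  qed (use assms in \<open>auto simp: chart_inv_chart\<close>)
qed

lemma velocity_eq:
  assumes "at t within S \<noteq> bot" "t \<in> S" "ch \<in> A" "c t \<in> fst ch"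
    and "eventually (\<lambda>\<tau>. c \<tau> \<in> fst ch) (at t within S)"
    and "(snd ch \<circ> c has_vector_derivative w) (at t within S)"
  shows "velocity A S c t = coord_field A ch w (c t)"
  unfolding velocity_def coord_field_eq
  using assms chart_at_in mem_chart_at in_points
  by (intro vector_derivative_within curve_change_chart) auto

lemma has_vector_derivative_velocity:
  assumes "at t within S \<noteq> bot" "t \<in> S" "ch \<in> A" "c t \<in> fst ch"
    and "eventually (\<lambda>\<tau>. c \<tau> \<in> fst ch) (at t within S)"
    and "(snd ch \<circ> c) differentiable (at t within S)"
  shows "(snd ch \<circ> c has_vector_derivative mdiff A (snd ch) (c t) (velocity A S c t)) (at t within S)"
proof -
  obtain w where w: "(snd ch \<circ> c has_vector_derivative w) (at t within S)"
    using assms(1,6) by (metis vector_derivative_works)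
  then have "velocity A S c t = coord_field A ch w (c t)"
    using assms by (intro velocity_eq) auto
  with w show ?thesis
    using assms by (simp add: mdiff_coord_field_same)
qed

lemma smooth_intoD:
  assumes "smooth_into A S f" "ch \<in> A"
  shows "openin (top_of_set S) {x\<in>S. f x \<in> fst ch}"
    and "smooth_on {x\<in>S. f x \<in> fst ch} (snd ch \<circ> f)"
    and "x \<in> S \<Longrightarrow> f x \<in> points A"
  using assms by (auto simp: smooth_into_def)

lemma smooth_into_ev:
  assumes "smooth_into A S f" "ch \<in> A" "t \<in> S" "f t \<in> fst ch"
  shows "eventually (\<lambda>\<tau>. f \<tau> \<in> fst ch) (at t within S)"
  using eventually_in_openin[OF smooth_intoD(1)[OF assms(1,2)], of t] assms
  by (auto elim: eventually_mono)

lemma smooth_into_differentiable: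
  assumes "smooth_into A S f" "ch \<in> A" "t \<in> S" "f t \<in> fst ch"
  shows "(snd ch \<circ> f) differentiable (at t within S)"
proof -
  have "Ck_on (Suc 0) {x\<in>S. f x \<in> fst ch} (snd ch \<circ> f)"
    using smooth_intoD(2)[OF assms(1,2)] smooth_onD by blast
  then have "(snd ch \<circ> f) differentiable (at t within {x\<in>S. f x \<in> fst ch})"
    using assms unfolding Ck_on.simps differentiable_def by blast
  then show ?thesis
    using at_within_openin[OF smooth_intoD(1)[OF assms(1,2)], of t] assms by simp
qed

lemma smooth_into_has_velocity:
  assumes "smooth_into A S c" "fat S" "ch \<in> A" "t \<in> S" "c t \<in> fst ch"
  shows "(snd ch \<circ> c has_vector_derivative mdiff A (snd ch) (c t) (velocity A S c t)) (at t within S)"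
  by (intro has_vector_derivative_velocity fat_at_within_neq_bot smooth_into_ev[OF assms(1)]
      smooth_into_differentiable[OF assms(1)]) (use assms in auto)

text \<open>One suitable chart near each point suffices. Where the image also lies in another chart,
  the preimage of the overlap is relatively open by continuity, and composing with the transition
  map gives smoothness there; \<open>smooth_on_local\<close> glues.\<close>

lemma smooth_into_localI:
  assumes "fat S"
    and loc: "\<And>x. x \<in> S \<Longrightarrow> \<exists>T. \<exists>ch\<in>A. openin (top_of_set S) T \<and> x \<in> T \<and> f ` T \<subseteq> fst ch \<and>
                smooth_on T (snd ch \<circ> f)"
  shows "smooth_into A S f"
  unfolding smooth_into_def
proof (intro conjI ballI)
  show "f ` S \<subseteq> points A"
    using loc unfolding points_def by fast
  fix ch' assume ch': "ch' \<in> A"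
  let ?D = "{x\<in>S. f x \<in> fst ch'}"
  have D: "\<exists>T. openin (top_of_set S) T \<and> x \<in> T \<and> T \<subseteq> ?D \<and> smooth_on T (snd ch' \<circ> f)" if "x \<in> ?D" for x
  proof -
    obtain T ch where T: "ch \<in> A" "openin (top_of_set S) T" "x \<in> T" "f ` T \<subseteq> fst ch"
        "smooth_on T (snd ch \<circ> f)"
      using loc[of x] \<open>x \<in> ?D\<close> by auto
    let ?V = "snd ch ` (fst ch \<inter> fst ch')"
    define U where "U = T \<inter> (snd ch \<circ> f) -` ?V"
    have "openin (top_of_set T) U"
      unfolding U_def
      by (rule continuous_openin_preimage_gen[OF smooth_on_imp_continuous_on[OF T(5)] open_overlap])
         (use T(1) ch' in auto)
    then have "openin (top_of_set S) U"
      using T(2) openin_trans by blast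
    moreover have "x \<in> U"
      using T \<open>x \<in> ?D\<close> unfolding U_def by auto
    moreover have U_D: "f y \<in> fst ch'" "snd ch' (chart_inv ch (snd ch (f y))) = snd ch' (f y)" if "y \<in> U" for y
      using that T(1,4) mem_overlap_iff[OF T(1), of "snd ch (f y)" ch'] unfolding U_def
      by (auto simp: chart_inv_chart image_subset_iff)
    moreover have "U \<subseteq> S"
      using T(2) openin_imp_subset unfolding U_def by blast
    moreover have "smooth_on U (\<lambda>y. (snd ch' \<circ> chart_inv ch) ((snd ch \<circ> f) y))"
      by (rule smooth_on_compose[OF smooth_on_subset[OF T(5)] smooth_transition[OF T(1) ch']])
         (auto simp: U_def)
    then have "smooth_on U (snd ch' \<circ> f)"
      by (rule smooth_on_cong) (use U_D in auto)
    ultimately show ?thesis by blast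
  qed
  show op: "openin (top_of_set S) ?D"
    unfolding openin_subopen[of _ ?D] using D by blast
  show "smooth_on ?D (snd ch' \<circ> f)"
  proof (rule smooth_on_local[OF fat_openin[OF assms(1) op]])
    fix x assume "x \<in> ?D"
    then obtain T where "openin (top_of_set S) T" "x \<in> T" "T \<subseteq> ?D" "smooth_on T (snd ch' \<circ> f)"
      using D by blast
    then show "\<exists>T. openin (top_of_set ?D) T \<and> x \<in> T \<and> smooth_on T (snd ch' \<circ> f)"
      using openin_subset_trans[of S T ?D] by blast
  qed
qed

lemma smooth_into_compose:
  fixes \<phi> :: "'c::euclidean_space \<Rightarrow> 'b::euclidean_space"
  assumes "smooth_into A S f" "smooth_on T \<phi>" "\<phi> ` T \<subseteq> S"
  shows "smooth_into A T (\<lambda>x. f (\<phi> x))"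
  unfolding smooth_into_def
proof (intro conjI ballI)
  show "(\<lambda>x. f (\<phi> x)) ` T \<subseteq> points A"
    using assms by (auto simp: smooth_into_def)
  fix ch assume ch: "ch \<in> A"
  note f = smooth_intoD[OF assms(1) ch]
  have eq: "{x\<in>T. f (\<phi> x) \<in> fst ch} = T \<inter> \<phi> -` {x\<in>S. f x \<in> fst ch}"
    using assms(3) by auto
  show "openin (top_of_set T) {x\<in>T. f (\<phi> x) \<in> fst ch}"
    unfolding eq using f(1) smooth_on_imp_continuous_on[OF assms(2)] assms(3)
    by (intro continuous_openin_preimage[where T = S]) auto
  have "smooth_on {x\<in>T. f (\<phi> x) \<in> fst ch} (\<lambda>x. (snd ch \<circ> f) (\<phi> x))"
    by (rule smooth_on_compose[OF smooth_on_subset[OF assms(2)] f(2)]) (use assms(3) in auto)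
  then show "smooth_on {x\<in>T. f (\<phi> x) \<in> fst ch} (snd ch \<circ> (\<lambda>x. f (\<phi> x)))"
    by (simp add: o_def)
qed

lemma smooth_into_subset: "smooth_into A S f \<Longrightarrow> T \<subseteq> S \<Longrightarrow> smooth_into A T f"
  using smooth_into_compose[of S f T "\<lambda>x. x"] smooth_on_ident by auto

text \<open>The witness is a straight line in the chart fixed for \<open>p\<close>. Applied to the
  tangent bundle, this shows that the choice in \<open>representing_curve\<close> succeeds.\<close>

lemma curve_with_velocity:
  assumes "p \<in> points A"
  shows "\<exists>\<sigma>. (\<exists>\<epsilon>>0. smooth_into A {-\<epsilon><..<\<epsilon>} \<sigma>) \<and> \<sigma> 0 = p \<and> velocity A UNIV \<sigma> 0 = \<xi>"
proof -
  let ?ch = "chart_at A p"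
  note ch = chart_at_in[OF assms] mem_chart_at[OF assms]
  define \<sigma>' where "\<sigma>' s = snd ?ch p + s *\<^sub>R \<xi>" for s :: real
  define \<sigma> where "\<sigma> s = chart_inv ?ch (\<sigma>' s)" for s
  have "isCont \<sigma>' 0"
    unfolding \<sigma>'_def by (intro continuous_intros)
  moreover have "\<sigma>' 0 \<in> snd ?ch ` fst ?ch"
    using ch by (simp add: \<sigma>'_def)
  ultimately have "eventually (\<lambda>s. \<sigma>' s \<in> snd ?ch ` fst ?ch) (at 0)"
    using open_chart_image[OF ch(1)] unfolding isCont_def tendsto_def by blast
  then obtain e where e: "e > 0" "\<And>s. s \<noteq> 0 \<Longrightarrow> \<bar>s\<bar> < e \<Longrightarrow> \<sigma>' s \<in> snd ?ch ` fst ?ch"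
    unfolding eventually_at by (auto simp: dist_real_def)
  have in': "\<sigma>' s \<in> snd ?ch ` fst ?ch" if "s \<in> {-e<..<e}" for s
    using e(2)[of s] that \<open>\<sigma>' 0 \<in> _\<close> by (cases "s = 0") auto
  have eq: "\<sigma> s \<in> fst ?ch" "snd ?ch (\<sigma> s) = \<sigma>' s" if "s \<in> {-e<..<e}" for s
    unfolding \<sigma>_def using in'[OF that] by (auto simp: chart_inv_in chart_chart_inv)
  have "smooth_on {-e<..<e} \<sigma>'"
    unfolding \<sigma>'_def by (intro smooth_on_add smooth_on_const smooth_on_scaleR smooth_on_ident)
  then have "smooth_on {-e<..<e} (snd ?ch \<circ> \<sigma>)"
    by (rule smooth_on_cong) (use eq in auto)
  then have "smooth_into A {-e<..<e} \<sigma>"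
    using ch eq by (intro smooth_into_localI fat_open exI[of _ "{-e<..<e}"] bexI[of _ ?ch]) auto
  moreover have "\<sigma> 0 = p"
    using ch by (simp add: \<sigma>_def \<sigma>'_def chart_inv_chart)
  moreover have "velocity A UNIV \<sigma> 0 = \<xi>"
  proof -
    have "(\<sigma>' has_vector_derivative \<xi>) (at 0)"
      unfolding \<sigma>'_def by (auto intro!: derivative_eq_intros)
    then have "(snd ?ch \<circ> \<sigma> has_vector_derivative \<xi>) (at 0)"
      by (rule has_vector_derivative_transform_within_open[where S = "{-e<..<e}"]) (use eq e in auto)
    moreover have "eventually (\<lambda>s. \<sigma> s \<in> fst ?ch) (at 0)"
      using eq(1) e(1) by (intro eventually_at_in_open'[THEN eventually_mono, of "{-e<..<e}"]) auto
    ultimately have "velocity A UNIV \<sigma> 0 = coord_field A ?ch \<xi> (\<sigma> 0)"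
      using ch \<open>\<sigma> 0 = p\<close> by (intro velocity_eq) auto
    then show ?thesis
      using \<open>\<sigma> 0 = p\<close> assms by (simp add: coord_field_center)
  qed
  ultimately show ?thesis using e(1) by blast
qed

section \<open>The tangent bundle\<close>

lemma fst_tangent_chart [simp]: "fst (tangent_chart A ch) = fst ch \<times> UNIV"
  and snd_tangent_chart [simp]: "snd (tangent_chart A ch) w = (snd ch (fst w), mdiff A (snd ch) (fst w) (snd w))"
  by (simp_all add: tangent_chart_def case_prod_unfold)

lemma tangent_chart_image:
  assumes "ch \<in> A"
  shows "snd (tangent_chart A ch) ` (fst (tangent_chart A ch) \<inter> fst (tangent_chart A ch')) =
         snd ch ` (fst ch \<inter> fst ch') \<times> UNIV"
proof (intro equalityI subsetI)
  fix y assume "y \<in> snd ch ` (fst ch \<inter> fst ch') \<times> (UNIV :: 'e set)"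
  then obtain p v where p: "p \<in> fst ch" "p \<in> fst ch'" "y = (snd ch p, v)"
    by (cases y) auto
  then have "y = snd (tangent_chart A ch) (p, coord_field A ch v p)"
    using assms by (simp add: mdiff_coord_field_same)
  moreover have "(p, coord_field A ch v p) \<in> fst (tangent_chart A ch) \<inter> fst (tangent_chart A ch')"
    using p by simp
  ultimately show "y \<in> snd (tangent_chart A ch) ` (fst (tangent_chart A ch) \<inter> fst (tangent_chart A ch'))"
    by blast
qed auto

lemma inj_on_tangent_chart:
  assumes "ch \<in> A"
  shows "inj_on (snd (tangent_chart A ch)) (fst (tangent_chart A ch))"
proof (rule inj_onI)
  fix w w' assume w: "w \<in> fst (tangent_chart A ch)" "w' \<in> fst (tangent_chart A ch)"
    "snd (tangent_chart A ch) w = snd (tangent_chart A ch) w'"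
  then have "fst w = fst w'"
    using inj_on_chart[OF assms] by (auto dest: inj_onD)
  moreover from this w have "snd w = snd w'"
    using assms coord_field_mdiff[of ch "fst w"] by (metis Pair_inject fst_tangent_chart mem_Times_iff snd_tangent_chart)
  ultimately show "w = w'" by (simp add: prod_eq_iff)
qed

lemma chart_inv_tangent_chart:
  assumes "ch \<in> A" "x \<in> snd ch ` fst ch"
  shows "chart_inv (tangent_chart A ch) (x, v) = (chart_inv ch x, coord_field A ch v (chart_inv ch x))"
  unfolding chart_inv_def[of "tangent_chart A ch"]
  by (rule inv_into_f_eq[OF inj_on_tangent_chart])
     (use assms in \<open>auto simp: chart_inv_chart mdiff_coord_field_same\<close>)

text \<open>The transition maps send (x, v) to the image of x and the Jacobian at x applied to v.
  Expanding v in the basis makes the joint smoothness in x and v visible.\<close>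

lemma smooth_manifold_tangent_bundle: "smooth_manifold (tangent_bundle A)"
proof
  show "smooth_atlas (tangent_bundle A)"
    unfolding smooth_atlas_def tangent_bundle_def ball_simps
  proof (intro conjI ballI inj_on_tangent_chart)
    fix ch ch' assume ch: "ch \<in> A" "ch' \<in> A"
    show "open (snd (tangent_chart A ch) ` (fst (tangent_chart A ch) \<inter> fst (tangent_chart A ch')))"
      unfolding tangent_chart_image[OF ch(1)] by (intro open_Times open_overlap ch open_UNIV)
    let ?O = "snd ch ` (fst ch \<inter> fst ch')"
    let ?\<tau> = "snd ch' \<circ> chart_inv ch"
    have fst': "smooth_on (?O \<times> UNIV) (\<lambda>y::'e \<times> 'e. f (fst y))" if "smooth_on ?O f"
      for f :: "'e \<Rightarrow> 'e"
      by (rule smooth_on_compose[OF smooth_on_fst[OF smooth_on_ident] that]) auto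
    have "smooth_on (?O \<times> UNIV) (\<lambda>y. (?\<tau> (fst y),
        \<Sum>b\<in>Basis. (snd y \<bullet> b) *\<^sub>R chart_diff ch ch' (chart_inv ch (fst y)) b))"
      by (intro smooth_on_Pair smooth_on_sum smooth_on_scaleR smooth_on_inner smooth_on_snd smooth_on_ident
          fst' smooth_transition smooth_chart_diff ch)
    moreover have "(?\<tau> (fst y), \<Sum>b\<in>Basis. (snd y \<bullet> b) *\<^sub>R chart_diff ch ch' (chart_inv ch (fst y)) b) =
        (snd (tangent_chart A ch') \<circ> chart_inv (tangent_chart A ch)) y" if "y \<in> ?O \<times> UNIV" for y
    proof -
      obtain x v where y: "y = (x, v)" by (cases y)
      then have x: "x \<in> snd ch ` fst ch" "chart_inv ch x \<in> fst ch" "chart_inv ch x \<in> fst ch'"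
        using that mem_overlap_iff[OF ch(1), of x ch'] by (simp_all add: chart_inv_in)
      have "(\<Sum>b\<in>Basis. (v \<bullet> b) *\<^sub>R chart_diff ch ch' (chart_inv ch x) b) =
          chart_diff ch ch' (chart_inv ch x) (\<Sum>b\<in>Basis. (v \<bullet> b) *\<^sub>R b)"
        using linear_chart_diff[OF ch x(2,3)] by (simp add: linear_sum linear_cmul)
      then show ?thesis
        using ch x by (simp add: y chart_inv_tangent_chart mdiff_coord_field euclidean_representation)
    qed
    ultimately show "smooth_on (snd (tangent_chart A ch) ` (fst (tangent_chart A ch) \<inter> fst (tangent_chart A ch')))
        (snd (tangent_chart A ch') \<circ> chart_inv (tangent_chart A ch))"
      unfolding tangent_chart_image[OF ch(1)] by (rule smooth_on_cong)
  qed
qed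

lemma points_tangent_bundle: "points (tangent_bundle A) = points A \<times> UNIV"
  by (auto simp: points_def tangent_bundle_def)

lemma tangent_chart_in: "ch \<in> A \<Longrightarrow> tangent_chart A ch \<in> tangent_bundle A"
  by (simp add: tangent_bundle_def)

end

section \<open>Variations of a curve\<close>

text \<open>The compact set \<open>{0} \<times> K\<close> has positive distance from the complement
  of an open set containing it. This yields one range of s that serves all t in
  \<open>K\<close>.\<close>

lemma tube_at_0:
  fixes K :: "real set" and \<epsilon> :: real
  assumes O: "openin (top_of_set ({-\<epsilon><..<\<epsilon>} \<times> J)) O'" and "\<epsilon> > 0" "compact K" "K \<subseteq> J" "{0} \<times> K \<subseteq> O'"
  shows "\<exists>\<delta>>0. \<delta> \<le> \<epsilon> \<and> {-\<delta><..<\<delta>} \<times> K \<subseteq> O'"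
proof -
  obtain W :: "(real \<times> real) set" where W: "open W" "O' = {-\<epsilon><..<\<epsilon>} \<times> J \<inter> W"
    using O by (auto simp: openin_open)
  have "\<exists>d>0. \<forall>x\<in>{0} \<times> K. \<forall>y\<in>-W. d \<le> dist x y"
    using assms W by (intro separate_compact_closed compact_Times) auto
  then obtain d where d: "d > 0" "\<And>t p. t \<in> K \<Longrightarrow> dist (0, t) p < d \<Longrightarrow> p \<in> W"
    by (force simp: not_le[symmetric])
  show ?thesis
  proof (intro exI[of _ "min d \<epsilon>"] conjI subsetI)
    fix p assume "p \<in> {- min d \<epsilon><..<min d \<epsilon>} \<times> K"
    then obtain s t where p: "p = (s, t)" "\<bar>s\<bar> < d" "\<bar>s\<bar> < \<epsilon>" "t \<in> K"
      by force
    then have "p \<in> W"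
      by (intro d(2)[of t]) (auto simp: dist_Pair_Pair)
    with p W assms(4) show "p \<in> O'" by auto
  qed (use d assms in auto)
qed

lemma slice_openin:
  assumes "openin (top_of_set (S \<times> T)) O'"
  shows "t \<in> T \<Longrightarrow> openin (top_of_set S) {s\<in>S. (s, t) \<in> O'}"
    and "s \<in> S \<Longrightarrow> openin (top_of_set T) {t\<in>T. (s, t) \<in> O'}"
proof -
  have "openin (top_of_set S) (S \<inter> (\<lambda>s. (s, t)) -` O')" if "t \<in> T"
    by (rule continuous_openin_preimage[OF _ _ assms]) (use that in \<open>auto intro!: continuous_intros\<close>)
  moreover have "openin (top_of_set T) (T \<inter> (\<lambda>t. (s, t)) -` O')" if "s \<in> S"
    by (rule continuous_openin_preimage[OF _ _ assms]) (use that in \<open>auto intro!: continuous_intros\<close>)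
  ultimately show "t \<in> T \<Longrightarrow> openin (top_of_set S) {s\<in>S. (s, t) \<in> O'}"
    and "s \<in> S \<Longrightarrow> openin (top_of_set T) {t\<in>T. (s, t) \<in> O'}"
    by (auto simp: vimage_def Int_def)
qed

lemma slice_has_vector_derivative:
  assumes O: "openin (top_of_set (S \<times> T)) O'" and st: "(s, t) \<in> O'"
    and f: "(f has_derivative f') (at (s, t) within O')"
  shows "((\<lambda>s. f (s, t)) has_vector_derivative f' (1, 0)) (at s within S)"
    and "((\<lambda>t. f (s, t)) has_vector_derivative f' (0, 1)) (at t within T)"
proof -
  have S: "s \<in> S" "t \<in> T"
    using openin_imp_subset[OF O] st by auto
  have scale: "f' (x *\<^sub>R p) = x *\<^sub>R f' p" for x p
    using linear_cmul[OF has_derivative_linear[OF f]] .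
  have "((\<lambda>s. (s, t)) has_derivative (\<lambda>x. (x, 0))) (at s within {s\<in>S. (s, t) \<in> O'})"
    by (intro has_derivative_Pair has_derivative_ident has_derivative_const)
  moreover have "(f has_derivative f') (at (s, t) within (\<lambda>s. (s, t)) ` {s\<in>S. (s, t) \<in> O'})"
    by (rule has_derivative_subset[OF f]) auto
  ultimately have "((\<lambda>s. f (s, t)) has_derivative (\<lambda>x. f' (x, 0))) (at s within {s\<in>S. (s, t) \<in> O'})"
    by (rule has_derivative_in_compose)
  moreover have "at s within {s\<in>S. (s, t) \<in> O'} = at s within S"
    using slice_openin(1)[OF O S(2)] S st by (intro at_within_openin) auto
  moreover have "(\<lambda>x. f' (x, 0)) = (\<lambda>x. x *\<^sub>R f' (1, 0))"
    by (simp flip: scale)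
  ultimately show "((\<lambda>s. f (s, t)) has_vector_derivative f' (1, 0)) (at s within S)"
    by (simp add: has_vector_derivative_def)
  have "((\<lambda>t. (s, t)) has_derivative (\<lambda>x. (0, x))) (at t within {t\<in>T. (s, t) \<in> O'})"
    by (intro has_derivative_Pair has_derivative_ident has_derivative_const)
  moreover have "(f has_derivative f') (at (s, t) within (\<lambda>t. (s, t)) ` {t\<in>T. (s, t) \<in> O'})"
    by (rule has_derivative_subset[OF f]) auto
  ultimately have "((\<lambda>t. f (s, t)) has_derivative (\<lambda>x. f' (0, x))) (at t within {t\<in>T. (s, t) \<in> O'})"
    by (rule has_derivative_in_compose)
  moreover have "at t within {t\<in>T. (s, t) \<in> O'} = at t within T"
    using slice_openin(2)[OF O S(1)] S st by (intro at_within_openin) auto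
  moreover have "(\<lambda>x. f' (0, x)) = (\<lambda>x. x *\<^sub>R f' (0, 1))"
    by (simp flip: scale)
  ultimately show "((\<lambda>t. f (s, t)) has_vector_derivative f' (0, 1)) (at t within T)"
    by (simp add: has_vector_derivative_def)
qed

section \<open>Partition of unity on an interval\<close>

text \<open>Finitely many of the intervals of radius \<open>\<delta> i\<close> cover by compactness.
  Bumps supported on them have a positive sum, and dividing by it normalises.\<close>

lemma smooth_partition_of_unity:
  fixes a b :: real
  assumes "\<And>t. t \<in> {a..b} \<Longrightarrow> \<delta> t > 0"
  shows "\<exists>I \<rho>. finite I \<and> I \<subseteq> {a..b} \<and>
    (\<forall>i\<in>I. smooth_on {a..b} (\<rho> i) \<and> (\<forall>t. \<delta> i \<le> \<bar>t - i\<bar> \<longrightarrow> \<rho> i t = 0)) \<and>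
    (\<forall>t\<in>{a..b}. (\<Sum>i\<in>I. \<rho> i t) = (1::real))"
proof -
  define \<beta> where "\<beta> = (\<lambda>x::real. if 0 < x then exp (- inverse x) else 0)"
  have \<beta>: "\<beta> x \<ge> 0" "x > 0 \<Longrightarrow> \<beta> x > 0" "x \<le> 0 \<Longrightarrow> \<beta> x = 0" for x
    by (auto simp: \<beta>_def)
  \<comment> \<open>The argument is \<open>\<delta> i\<close> squared minus the squared distance,
    hence positive exactly inside the interval; it is spelled with sums and products to match the
    smoothness rules.\<close>
  define \<psi> where "\<psi> i t = \<beta> (\<delta> i * \<delta> i + - 1 * ((t + - i) * (t + - i)))" for i t
  have arg: "\<bar>t - i\<bar> < \<delta> i \<longleftrightarrow> 0 < \<delta> i * \<delta> i + - 1 * ((t + - i) * (t + - i))" if "i \<in> {a..b}" for i t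
  proof -
    have "\<delta> i \<le> \<bar>t - i\<bar> \<longleftrightarrow> \<delta> i * \<delta> i \<le> (t + - i) * (t + - i)"
      using assms[OF that] abs_le_square_iff[of "\<delta> i" "t - i"] by (simp add: power2_eq_square)
    then show ?thesis by linarith
  qed
  obtain I where I: "I \<subseteq> {a..b}" "finite I" "{a..b} \<subseteq> (\<Union>i\<in>I. ball i (\<delta> i))"
  proof (rule compactE_image[OF compact_Icc[of a b], of "{a..b}" "\<lambda>i. ball i (\<delta> i)"])
    show "{a..b} \<subseteq> (\<Union>i\<in>{a..b}. ball i (\<delta> i))"
      using assms by (meson UN_I centre_in_ball subsetI)
  qed (rule open_ball)
  have \<psi>_smooth: "smooth_on {a..b} (\<psi> i)" for i
    unfolding \<psi>_def
    by (rule smooth_on_compose[OF _ smooth_on_bump[folded \<beta>_def]],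
        intro smooth_on_add smooth_on_mult smooth_on_const smooth_on_ident) simp
  define \<Psi> where "\<Psi> t = (\<Sum>i\<in>I. \<psi> i t)" for t
  have \<Psi>_pos: "\<Psi> t > 0" if t: "t \<in> {a..b}" for t
  proof -
    obtain i where "i \<in> I" "t \<in> ball i (\<delta> i)"
      using I(3) t by blast
    then have i: "i \<in> I" "\<bar>t - i\<bar> < \<delta> i"
      by (simp_all add: dist_real_def abs_minus_commute)
    then have "\<psi> i t > 0"
      using arg[of i t] I(1) \<beta>(2) unfolding \<psi>_def by blast
    then show ?thesis
      unfolding \<Psi>_def using i I(2) \<beta>(1) by (intro sum_pos2[of I i]) (auto simp: \<psi>_def)
  qed
  define \<rho> where "\<rho> i t = \<psi> i t * inverse (\<Psi> t)" for i t
  have "smooth_on {a..b} (\<lambda>t. inverse (\<Psi> t))"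
  proof (rule smooth_on_compose[where f = \<Psi> and T = "- {0}" and g = inverse])
    show "smooth_on {a..b} \<Psi>"
      unfolding \<Psi>_def by (intro smooth_on_sum \<psi>_smooth)
    show "smooth_on (- {0}) (inverse :: real \<Rightarrow> real)"
      by (rule smooth_onI) (rule Ck_on_inverse)
    show "\<Psi> ` {a..b} \<subseteq> - {0}"
      using \<Psi>_pos by force
  qed
  then have "smooth_on {a..b} (\<rho> i)" for i
    unfolding \<rho>_def by (intro smooth_on_mult \<psi>_smooth)
  moreover have "\<rho> i t = 0" if "i \<in> I" "\<delta> i \<le> \<bar>t - i\<bar>" for i t
  proof -
    have i: "i \<in> {a..b}" using that I(1) by blast
    have "\<not> 0 < \<delta> i * \<delta> i + - 1 * ((t + - i) * (t + - i))"
      using arg[OF i, of t] leD[OF that(2)] by blast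
    then show ?thesis
      unfolding \<rho>_def \<psi>_def using \<beta>(3) by (metis mult_zero_left not_less)
  qed
  moreover have "(\<Sum>i\<in>I. \<rho> i t) = 1" if "t \<in> {a..b}" for t
    using \<Psi>_pos[OF that] unfolding \<rho>_def sum_distrib_right[symmetric] \<Psi>_def[symmetric] by simp
  ultimately show ?thesis
    using I(1,2) by (intro exI[of _ I] exI[of _ \<rho>]) simp
qed

context smooth_manifold
begin

lemma smooth_into_slice:
  assumes "smooth_into A (S \<times> T) (\<lambda>(s, t). \<gamma> s t)"
  shows "t \<in> T \<Longrightarrow> smooth_into A S (\<lambda>s. \<gamma> s t)" and "s \<in> S \<Longrightarrow> smooth_into A T (\<gamma> s)"
proof -
  have "smooth_into A S (\<lambda>s. (\<lambda>(s, t). \<gamma> s t) (s, t))" if "t \<in> T"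
    by (rule smooth_into_compose[OF assms]) (use that in \<open>auto intro!: smooth_on_Pair smooth_on_const smooth_on_ident\<close>)
  moreover have "smooth_into A T (\<lambda>t. (\<lambda>(s, t). \<gamma> s t) (s, t))" if "s \<in> S"
    by (rule smooth_into_compose[OF assms]) (use that in \<open>auto intro!: smooth_on_Pair smooth_on_const smooth_on_ident\<close>)
  ultimately show "t \<in> T \<Longrightarrow> smooth_into A S (\<lambda>s. \<gamma> s t)" and "s \<in> S \<Longrightarrow> smooth_into A T (\<gamma> s)"
    by auto
qed

lemma velocity_open: "open S \<Longrightarrow> s \<in> S \<Longrightarrow> velocity A S c s = velocity A UNIV c s"
  by (simp add: velocity_def at_within_open[of s S])

lemma velocity_cong:
  assumes "t \<in> S" "\<And>\<tau>. \<tau> \<in> S \<Longrightarrow> c \<tau> = c' \<tau>"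
  shows "velocity A S c t = velocity A S c' t"
  unfolding velocity_def assms(2)[OF assms(1)]
  by (rule vector_derivative_cong_eq) (use assms in auto)

section \<open>Coordinate velocities of a map of two parameters\<close>

text \<open>Expressed through \<open>velocity\<close>, and not as a derivative of coordinates, so as
  to match \<open>variation\<close>; \<open>partial_velocities\<close> identifies it with the
  partial derivative.\<close>

definition s_velocity :: "('a, 'e) chart \<Rightarrow> (real \<Rightarrow> real \<Rightarrow> 'a) \<Rightarrow> real \<times> real \<Rightarrow> 'e" where
  "s_velocity ch \<gamma> p =
     mdiff A (snd ch) (\<gamma> (fst p) (snd p)) (velocity A UNIV (\<lambda>s. \<gamma> s (snd p)) (fst p))"

definition t_velocity :: "('a, 'e) chart \<Rightarrow> (real \<Rightarrow> real \<Rightarrow> 'a) \<Rightarrow> real \<times> real \<Rightarrow> 'e" where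
  "t_velocity ch \<gamma> p =
     mdiff A (snd ch) (\<gamma> (fst p) (snd p)) (velocity A {0..1} (\<gamma> (fst p)) (snd p))"

text \<open>Along slices, uniqueness of derivatives forces the values of the joint derivative at (1,
  0) and (0, 1) to be the two velocities. Velocities defined slice by slice thereby become smooth in
  both parameters.\<close>

lemma partial_velocities:
  fixes \<epsilon> :: real
  assumes \<gamma>: "smooth_into A ({-\<epsilon><..<\<epsilon>} \<times> {0..1}) (\<lambda>(s, t). \<gamma> s t)" and ch: "ch \<in> A"
  defines "O' \<equiv> {p \<in> {-\<epsilon><..<\<epsilon>} \<times> {0..1}. \<gamma> (fst p) (snd p) \<in> fst ch}"
  shows "openin (top_of_set ({-\<epsilon><..<\<epsilon>} \<times> {0..1})) O'"
    and "smooth_on O' (\<lambda>p. snd ch (\<gamma> (fst p) (snd p)))"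
    and "p \<in> O' \<Longrightarrow> ((\<lambda>p. snd ch (\<gamma> (fst p) (snd p))) has_derivative
           (\<lambda>q. fst q *\<^sub>R s_velocity ch \<gamma> p + snd q *\<^sub>R t_velocity ch \<gamma> p)) (at p within O')"
    and "smooth_on O' (s_velocity ch \<gamma>)" and "smooth_on O' (t_velocity ch \<gamma>)"
proof -
  have O'_eq: "O' = {p \<in> {-\<epsilon><..<\<epsilon>} \<times> {0..1}. (\<lambda>(s, t). \<gamma> s t) p \<in> fst ch}"
    by (auto simp: O'_def)
  show op: "openin (top_of_set ({-\<epsilon><..<\<epsilon>} \<times> {0..1})) O'"
    unfolding O'_eq by (rule smooth_intoD(1)[OF \<gamma> ch])
  have sm: "smooth_on O' (snd ch \<circ> (\<lambda>(s, t). \<gamma> s t))"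
    unfolding O'_eq by (rule smooth_intoD(2)[OF \<gamma> ch])
  then show X: "smooth_on O' (\<lambda>p. snd ch (\<gamma> (fst p) (snd p)))"
    by (rule smooth_on_cong) auto
  let ?X = "\<lambda>p. snd ch (\<gamma> (fst p) (snd p))"
  have vel: "f' (1, 0) = s_velocity ch \<gamma> p" "f' (0, 1) = t_velocity ch \<gamma> p"
    if p: "p \<in> O'" and f': "(?X has_derivative f') (at p within O')" for f' p
  proof -
    obtain s t where st: "p = (s, t)" "s \<in> {-\<epsilon><..<\<epsilon>}" "t \<in> {0..1}" "\<gamma> s t \<in> fst ch" "(s, t) \<in> O'"
      using p by (cases p) (auto simp: O'_def)
    have "((\<lambda>s. ?X (s, t)) has_vector_derivative f' (1, 0)) (at s within {-\<epsilon><..<\<epsilon>})"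
      by (rule slice_has_vector_derivative(1)[OF op st(5)]) (use f' st in simp)
    moreover have "(snd ch \<circ> (\<lambda>s. \<gamma> s t) has_vector_derivative
        mdiff A (snd ch) (\<gamma> s t) (velocity A {-\<epsilon><..<\<epsilon>} (\<lambda>s. \<gamma> s t) s)) (at s within {-\<epsilon><..<\<epsilon>})"
      by (rule smooth_into_has_velocity[OF smooth_into_slice(1)[OF \<gamma>]])
         (use st ch fat_open[OF open_greaterThanLessThan] in auto)
    ultimately show "f' (1, 0) = s_velocity ch \<gamma> p"
      using vector_derivative_unique_within[OF fat_at_within_neq_bot[OF fat_open[OF open_greaterThanLessThan] st(2)]]
        velocity_open[OF open_greaterThanLessThan st(2)]
      unfolding s_velocity_def st(1) by (simp add: o_def)
    have "((\<lambda>t. ?X (s, t)) has_vector_derivative f' (0, 1)) (at t within {0..1})"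
      by (rule slice_has_vector_derivative(2)[OF op st(5)]) (use f' st in simp)
    moreover have "(snd ch \<circ> \<gamma> s has_vector_derivative
        mdiff A (snd ch) (\<gamma> s t) (velocity A {0..1} (\<gamma> s) t)) (at t within {0..1})"
      by (rule smooth_into_has_velocity[OF smooth_into_slice(2)[OF \<gamma>]])
         (use st ch fat_interval in auto)
    ultimately show "f' (0, 1) = t_velocity ch \<gamma> p"
      using vector_derivative_unique_within[OF fat_at_within_neq_bot[OF fat_interval[OF zero_less_one] st(3)]]
      unfolding t_velocity_def st(1) by (simp add: o_def)
  qed
  have D: "\<exists>f'. (\<forall>p\<in>O'. (?X has_derivative f' p) (at p within O')) \<and> (\<forall>v. Ck_on k O' (\<lambda>p. f' p v))" for k
    using smooth_onD[OF X, of "Suc k"] by simp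
  show "(?X has_derivative (\<lambda>q. fst q *\<^sub>R s_velocity ch \<gamma> p + snd q *\<^sub>R t_velocity ch \<gamma> p)) (at p within O')"
    if p: "p \<in> O'"
  proof -
    obtain f' where f': "(?X has_derivative f') (at p within O')"
      using D[of 0] p by blast
    have "f' q = fst q *\<^sub>R f' (1, 0) + snd q *\<^sub>R f' (0, 1)" for q
    proof -
      note lin = has_derivative_linear[OF f']
      have "f' q = f' (fst q *\<^sub>R (1, 0) + snd q *\<^sub>R (0, 1))"
        by (cases q) simp
      then show ?thesis
        by (simp only: linear_add[OF lin] linear_cmul[OF lin])
    qed
    then have "f' = (\<lambda>q. fst q *\<^sub>R s_velocity ch \<gamma> p + snd q *\<^sub>R t_velocity ch \<gamma> p)"
      unfolding vel[OF p f'] by blast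
    with f' show ?thesis by simp
  qed
  show "smooth_on O' (s_velocity ch \<gamma>)"
  proof (rule smooth_onI)
    fix k show "Ck_on k O' (s_velocity ch \<gamma>)"
    proof -
      obtain f' where f': "\<forall>p\<in>O'. (?X has_derivative f' p) (at p within O')" "\<forall>v. Ck_on k O' (\<lambda>p. f' p v)"
        using D by blast
      then show ?thesis
        using vel(1) by (intro Ck_on_cong[OF f'(2)[rule_format]]) auto
    qed
  qed
  show "smooth_on O' (t_velocity ch \<gamma>)"
  proof (rule smooth_onI)
    fix k show "Ck_on k O' (t_velocity ch \<gamma>)"
    proof -
      obtain f' where f': "\<forall>p\<in>O'. (?X has_derivative f' p) (at p within O')" "\<forall>v. Ck_on k O' (\<lambda>p. f' p v)"
        using D by blast
      then show ?thesis
        using vel(2) by (intro Ck_on_cong[OF f'(2)[rule_format]]) auto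
    qed
  qed
qed

section \<open>Construction of a deformation with prescribed velocity\<close>

text \<open>A \<open>variation\<close> without the demand that the intermediate curves be
  immersions. The construction starts from the constant deformation and proceeds by adding pieces;
  the immersion property is recovered once at the end by shrinking the range of s.\<close>

definition deforms :: "(real \<Rightarrow> 'a) \<Rightarrow> (real \<Rightarrow> 'e) \<Rightarrow> (real \<Rightarrow> real \<Rightarrow> 'a) \<Rightarrow> bool" where
  "deforms c h \<gamma> \<longleftrightarrow>
     (\<exists>\<epsilon>>0. smooth_into A ({-\<epsilon><..<\<epsilon>} \<times> {0..1}) (\<lambda>(s, t). \<gamma> s t)) \<and>
     (\<forall>t\<in>{0..1}. \<gamma> 0 t = c t \<and> velocity A UNIV (\<lambda>s. \<gamma> s t) 0 = h t)"

lemma smooth_T_Imm: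
  assumes "h \<in> T_Imm A c" "ch \<in> A"
  shows "openin (top_of_set {0..1}) {t\<in>{0..1}. c t \<in> fst ch}"
    and "smooth_on {t\<in>{0..1}. c t \<in> fst ch} (\<lambda>t. mdiff A (snd ch) (c t) (h t))"
    and "smooth_on {t\<in>{0..1}. c t \<in> fst ch} (\<lambda>t. snd ch (c t))"
proof -
  interpret TM: smooth_manifold "tangent_bundle A"
    by (rule smooth_manifold_tangent_bundle)
  have "smooth_into (tangent_bundle A) {0..1} (\<lambda>t. (c t, h t))"
    using assms by (simp add: T_Imm_def)
  note D = TM.smooth_intoD(1,2)[OF this tangent_chart_in[OF assms(2)]]
  show "openin (top_of_set {0..1}) {t\<in>{0..1}. c t \<in> fst ch}"
    using D(1) by simp
  have eq: "snd (tangent_chart A ch) \<circ> (\<lambda>t. (c t, h t)) = (\<lambda>t. (snd ch (c t), mdiff A (snd ch) (c t) (h t)))"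
    by auto
  have "smooth_on {t\<in>{0..1}. c t \<in> fst ch} (\<lambda>t. (snd ch (c t), mdiff A (snd ch) (c t) (h t)))"
    using D(2) unfolding eq by simp
  from smooth_on_snd[OF this] smooth_on_fst[OF this]
  show "smooth_on {t\<in>{0..1}. c t \<in> fst ch} (\<lambda>t. mdiff A (snd ch) (c t) (h t))"
    "smooth_on {t\<in>{0..1}. c t \<in> fst ch} (\<lambda>t. snd ch (c t))"
    by simp_all
qed

text \<open>In the coordinates of \<open>ch\<close> the new deformation adds the linear term \<open>s * \<rho> t *\<^sub>R h t\<close>.\<close>

lemma deforms_add:
  assumes "deforms c (\<lambda>t. \<theta> t *\<^sub>R h t) \<gamma>" and h: "h \<in> T_Imm A c" and \<rho>: "smooth_on {0..1} \<rho>"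
    and K: "compact K" "K \<subseteq> {0..1}" "c ` K \<subseteq> fst ch" and ch: "ch \<in> A"
    and \<rho>0: "\<And>t. t \<in> {0..1} - K \<Longrightarrow> \<rho> t = 0"
  shows "\<exists>\<gamma>'. deforms c (\<lambda>t. (\<theta> t + \<rho> t) *\<^sub>R h t) \<gamma>'"
proof -
  obtain \<epsilon> where \<epsilon>: "\<epsilon> > 0" "smooth_into A ({-\<epsilon><..<\<epsilon>} \<times> {0..1}) (\<lambda>(s, t). \<gamma> s t)"
    and \<gamma>0: "\<And>t. t \<in> {0..1} \<Longrightarrow> \<gamma> 0 t = c t"
    and \<gamma>h: "\<And>t. t \<in> {0..1} \<Longrightarrow> velocity A UNIV (\<lambda>s. \<gamma> s t) 0 = \<theta> t *\<^sub>R h t"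
    using assms(1) unfolding deforms_def by blast
  let ?R = "{-\<epsilon><..<\<epsilon>} \<times> {0..1::real}"
  define O0 where "O0 = {p\<in>?R. \<gamma> (fst p) (snd p) \<in> fst ch}"
  note pv = partial_velocities[OF \<epsilon>(2) ch, folded O0_def]
  define H where "H t = mdiff A (snd ch) (c t) (h t)" for t
  define J where "J = {t\<in>{0..1}. c t \<in> fst ch}"
  note TJ = smooth_T_Imm[OF h ch, folded J_def H_def]
  define O1 where "O1 = O0 \<inter> {p\<in>?R. snd p \<in> J}"
  have "openin (top_of_set ?R) {p\<in>?R. snd p \<in> J}"
  proof -
    have "{p\<in>?R. snd p \<in> J} = ?R \<inter> snd -` J" by auto
    moreover have "openin (top_of_set ?R) (?R \<inter> snd -` J)"
      by (rule continuous_openin_preimage[OF _ _ TJ(1)]) (auto intro!: continuous_intros)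
    ultimately show ?thesis by simp
  qed
  then have O1: "openin (top_of_set ?R) O1"
    unfolding O1_def using pv(1) by blast
  define y where "y p = snd ch (\<gamma> (fst p) (snd p)) + (fst p * \<rho> (snd p)) *\<^sub>R H (snd p)" for p
  have y: "smooth_on O1 y"
    unfolding y_def
  proof (intro smooth_on_add smooth_on_scaleR smooth_on_mult)
    show "smooth_on O1 (\<lambda>p. snd ch (\<gamma> (fst p) (snd p)))"
      by (rule smooth_on_subset[OF pv(2)]) (auto simp: O1_def)
    show "smooth_on O1 (\<lambda>p. \<rho> (snd p))"
      by (rule smooth_on_compose[OF smooth_on_snd[OF smooth_on_ident] \<rho>]) (auto simp: O1_def)
    show "smooth_on O1 (\<lambda>p. H (snd p))"
      by (rule smooth_on_compose[OF smooth_on_snd[OF smooth_on_ident] TJ(2)]) (auto simp: O1_def)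
  qed (rule smooth_on_fst[OF smooth_on_ident])
  \<comment> \<open>The parameters for which the modified coordinates still lie in the image of the
    chart. For s = 0 they are those of \<open>c t\<close>, so \<open>{0} \<times> K\<close> belongs
    to it.\<close>
  define O2 where "O2 = O1 \<inter> y -` (snd ch ` fst ch)"
  have "openin (top_of_set O1) O2"
    unfolding O2_def
    by (rule continuous_openin_preimage_gen[OF smooth_on_imp_continuous_on[OF y] open_chart_image[OF ch]])
  then have O2: "openin (top_of_set ?R) O2"
    using O1 openin_trans by blast
  have "{0} \<times> K \<subseteq> O2"
    using K \<epsilon>(1) \<gamma>0 by (auto simp: O2_def O1_def O0_def J_def y_def image_subset_iff subset_iff)
  then obtain \<delta> where \<delta>: "\<delta> > 0" "\<delta> \<le> \<epsilon>" "{-\<delta><..<\<delta>} \<times> K \<subseteq> O2"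
    using tube_at_0[OF O2 \<epsilon>(1) K(1,2)] by blast
  \<comment> \<open>Where \<open>\<rho>\<close> vanishes the old value is kept, even if it lies
    outside the chart. On \<open>O2\<close> the two cases agree, since there \<open>y\<close> is
    then the coordinate of the old point.\<close>
  define \<gamma>' where "\<gamma>' s t = (if \<rho> t = 0 then \<gamma> s t else chart_inv ch (y (s, t)))" for s t
  have \<gamma>'_O2: "\<gamma>' (fst p) (snd p) \<in> fst ch" "snd ch (\<gamma>' (fst p) (snd p)) = y p" if "p \<in> O2" for p
  proof -
    have "\<gamma>' (fst p) (snd p) = chart_inv ch (y p)"
      using that chart_inv_chart[OF ch] unfolding \<gamma>'_def by (auto simp: O2_def O1_def O0_def y_def)
    with that show "\<gamma>' (fst p) (snd p) \<in> fst ch" "snd ch (\<gamma>' (fst p) (snd p)) = y p"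
      by (simp_all add: O2_def chart_inv_in chart_chart_inv)
  qed
  let ?R' = "{-\<delta><..<\<delta>} \<times> {0..1::real}"
  have R': "?R' \<subseteq> ?R" using \<delta> by auto
  have opR': "openin (top_of_set ?R') (U \<inter> ?R')" if "openin (top_of_set ?R) U" for U
    using that R' by (auto simp: openin_open)
  have "smooth_into A ?R' (\<lambda>(s, t). \<gamma>' s t)"
  proof (rule smooth_into_localI[OF fat_Times[OF fat_open[OF open_greaterThanLessThan] fat_interval[OF zero_less_one]]])
    fix p assume p: "p \<in> ?R'"
    show "\<exists>T. \<exists>ch\<in>A. openin (top_of_set ?R') T \<and> p \<in> T \<and> (\<lambda>(s, t). \<gamma>' s t) ` T \<subseteq> fst ch \<and>
        smooth_on T (snd ch \<circ> (\<lambda>(s, t). \<gamma>' s t))"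
    \<comment> \<open>Over \<open>K\<close> the formula in the chart is smooth. Off
      \<open>K\<close>, which is closed, \<open>\<rho>\<close> vanishes near the point, so nothing
      has changed and any chart for the old deformation works.\<close>
    proof (cases "snd p \<in> K")
      case True
      have "smooth_on (O2 \<inter> ?R') y"
        by (rule smooth_on_subset[OF y]) (auto simp: O2_def)
      then have "smooth_on (O2 \<inter> ?R') (snd ch \<circ> (\<lambda>(s, t). \<gamma>' s t))"
        by (rule smooth_on_cong) (use \<gamma>'_O2 in auto)
      moreover have "p \<in> O2"
        using p \<delta>(3) True by (auto simp: mem_Times_iff)
      ultimately show ?thesis
        using opR'[OF O2] p ch \<gamma>'_O2(1)
        by (intro exI[of _ "O2 \<inter> ?R'"] bexI[of _ ch]) auto
    next
      case False
      define ch' where "ch' = chart_at A (\<gamma> (fst p) (snd p))"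
      have "\<gamma> (fst p) (snd p) \<in> points A"
        using smooth_intoD(3)[OF \<epsilon>(2) ch, of p] p R' by (auto simp: case_prod_unfold)
      then have ch': "ch' \<in> A" "\<gamma> (fst p) (snd p) \<in> fst ch'"
        by (auto simp: ch'_def chart_at_in mem_chart_at)
      define Q where "Q = {p\<in>?R. \<gamma> (fst p) (snd p) \<in> fst ch'}"
      note Q = partial_velocities(1,2)[OF \<epsilon>(2) ch'(1), folded Q_def]
      define T where "T = Q \<inter> (UNIV \<times> - K) \<inter> ?R'"
      have "open (UNIV \<times> - K :: (real \<times> real) set)"
        using K(1) compact_imp_closed by (intro open_Times) auto
      then have "openin (top_of_set ?R') T"
        unfolding T_def using opR' Q(1) openin_Int_open by blast
      moreover have \<gamma>': "\<gamma>' (fst q) (snd q) = \<gamma> (fst q) (snd q)" if "q \<in> T" for q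
        using that \<rho>0[of "snd q"] by (auto simp: T_def \<gamma>'_def)
      moreover have "smooth_on T (snd ch' \<circ> (\<lambda>(s, t). \<gamma>' s t))"
        by (rule smooth_on_cong[OF smooth_on_subset[OF Q(2)]])
           (use \<gamma>' in \<open>auto simp: T_def\<close>)
      moreover have "p \<in> T"
        using p R' False ch'(2) by (auto simp: T_def Q_def)
      ultimately show ?thesis
        using ch'(1) by (intro exI[of _ T] bexI[of _ ch']) (auto simp: T_def Q_def)
    qed
  qed
  moreover have "\<gamma>' 0 t = c t \<and> velocity A UNIV (\<lambda>s. \<gamma>' s t) 0 = (\<theta> t + \<rho> t) *\<^sub>R h t" if t: "t \<in> {0..1}" for t
  proof (cases "\<rho> t = 0")
    case True
    then show ?thesis
      using \<gamma>0 \<gamma>h t by (simp add: \<gamma>'_def)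
  next
    case False
    then have tK: "t \<in> K" using \<rho>0 t by blast
    have ct: "c t \<in> fst ch" using K tK by auto
    have O2t: "(s, t) \<in> O2" if "s \<in> {-\<delta><..<\<delta>}" for s
      using that tK \<delta>(3) by auto
    have \<gamma>'0: "\<gamma>' 0 t = c t"
      using ct False \<gamma>0[OF t] ch by (simp add: \<gamma>'_def y_def chart_inv_chart)
    have "(0, t) \<in> O0"
      using t \<epsilon> \<gamma>0 ct by (simp add: O0_def)
    from slice_has_vector_derivative(1)[OF pv(1) this pv(3)[OF this]]
    have "((\<lambda>s. snd ch (\<gamma> s t)) has_vector_derivative \<theta> t *\<^sub>R H t) (at 0)"
      using \<epsilon>(1) \<gamma>0[OF t] \<gamma>h[OF t] linear_cmul[OF linear_mdiff_chart[OF ch ct]]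
      by (simp add: s_velocity_def H_def at_within_open[of 0 "{-\<epsilon><..<\<epsilon>}"])
    then have "((\<lambda>s. y (s, t)) has_vector_derivative (\<theta> t + \<rho> t) *\<^sub>R H t) (at 0)"
      unfolding y_def by (auto intro!: derivative_eq_intros simp: scaleR_add_left)
    then have "((\<lambda>s. snd ch (\<gamma>' s t)) has_vector_derivative (\<theta> t + \<rho> t) *\<^sub>R H t) (at 0)"
      by (rule has_vector_derivative_transform_within_open[where S = "{-\<delta><..<\<delta>}"])
         (use \<delta>(1) \<gamma>'_O2(2)[OF O2t] in auto)
    moreover have "eventually (\<lambda>s. \<gamma>' s t \<in> fst ch) (at 0)"
      using \<gamma>'_O2(1)[OF O2t] \<delta>(1)
      by (intro eventually_at_in_open'[THEN eventually_mono, of "{-\<delta><..<\<delta>}"]) auto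
    ultimately have "velocity A UNIV (\<lambda>s. \<gamma>' s t) 0 = coord_field A ch ((\<theta> t + \<rho> t) *\<^sub>R H t) (c t)"
      using velocity_eq[of 0 UNIV ch "\<lambda>s. \<gamma>' s t"] ch ct \<gamma>'0 by (simp add: o_def)
    also have "\<dots> = (\<theta> t + \<rho> t) *\<^sub>R h t"
      using linear_cmul[OF linear_coord_field[OF ch ct]] coord_field_mdiff[OF ch ct] by (simp add: H_def)
    finally show ?thesis using \<gamma>'0 by simp
  qed
  ultimately show ?thesis
    using \<delta>(1) unfolding deforms_def by blast
qed

lemma deforms_zero:
  assumes "smooth_into A {0..1} c"
  shows "deforms c (\<lambda>t. 0) (\<lambda>s. c)"
proof -
  have "smooth_into A ({-1<..<1::real} \<times> {0..1}) (\<lambda>p. c (snd p))"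
    by (rule smooth_into_compose[OF assms smooth_on_snd[OF smooth_on_ident]]) auto
  moreover have "velocity A UNIV (\<lambda>s. c t) 0 = 0" if "t \<in> {0..1}" for t
    by (simp add: velocity_def o_def)
  ultimately show ?thesis
    unfolding deforms_def by (auto simp: case_prod_unfold intro!: exI[of _ "1::real"])
qed

lemma deforms_exists:
  assumes c: "smooth_into A {0..1} c" and h: "h \<in> T_Imm A c"
  shows "\<exists>\<gamma>. deforms c h \<gamma>"
proof -
  have "\<exists>\<delta>>0. \<forall>\<tau>\<in>{0..1}. \<bar>\<tau> - t\<bar> \<le> \<delta> \<longrightarrow> c \<tau> \<in> fst (chart_at A (c t))" if t: "t \<in> {0..1}" for t
  proof -
    have ct: "c t \<in> points A"
      using c t by (auto simp: smooth_into_def)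
    have "openin (top_of_set {0..1}) {\<tau>\<in>{0..1}. c \<tau> \<in> fst (chart_at A (c t))}"
      by (rule smooth_intoD(1)[OF c chart_at_in[OF ct]])
    moreover have "t \<in> {\<tau>\<in>{0..1}. c \<tau> \<in> fst (chart_at A (c t))}"
      using t mem_chart_at[OF ct] by simp
    ultimately obtain e where e: "e > 0" "ball t e \<inter> {0..1} \<subseteq> {\<tau>\<in>{0..1}. c \<tau> \<in> fst (chart_at A (c t))}"
      unfolding openin_contains_ball by blast
    \<comment> \<open>Halving the radius yields a closed interval mapped into the chart, which will
      serve as the compact set for \<open>deforms_add\<close>.\<close>
    then show ?thesis
      by (intro exI[of _ "e/2"]) (auto simp: dist_real_def abs_minus_commute subset_iff)
  qed
  then obtain \<delta> where \<delta>: "\<And>t. t \<in> {0..1} \<Longrightarrow> \<delta> t > 0"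
      "\<And>t \<tau>. t \<in> {0..1} \<Longrightarrow> \<tau> \<in> {0..1} \<Longrightarrow> \<bar>\<tau> - t\<bar> \<le> \<delta> t \<Longrightarrow> c \<tau> \<in> fst (chart_at A (c t))"
    by metis
  have "\<exists>I \<rho>. finite I \<and> I \<subseteq> {0..1} \<and>
    (\<forall>i\<in>I. smooth_on {0..1} (\<rho> i) \<and> (\<forall>t. \<delta> i \<le> \<bar>t - i\<bar> \<longrightarrow> \<rho> i t = 0)) \<and>
    (\<forall>t\<in>{0..1}. (\<Sum>i\<in>I. \<rho> i t) = (1::real))"
    by (rule smooth_partition_of_unity) (rule \<delta>(1))
  then obtain I \<rho> where I: "finite I" "I \<subseteq> {0..1}"
    and \<rho>': "\<forall>i\<in>I. smooth_on {0..1} (\<rho> i) \<and> (\<forall>t. \<delta> i \<le> \<bar>t - i\<bar> \<longrightarrow> \<rho> i t = 0)"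
      "\<forall>t\<in>{0..1}. (\<Sum>i\<in>I. \<rho> i t) = (1::real)"
    by (elim exE conjE) (rule that)
  then have \<rho>: "\<And>i. i \<in> I \<Longrightarrow> smooth_on {0..1} (\<rho> i)" "\<And>i t. i \<in> I \<Longrightarrow> \<delta> i \<le> \<bar>t - i\<bar> \<Longrightarrow> \<rho> i t = 0"
      "\<And>t. t \<in> {0..1} \<Longrightarrow> (\<Sum>i\<in>I. \<rho> i t) = 1"
    by blast+
  \<comment> \<open>The induction over subsets of \<open>I\<close> realises \<open>h\<close> scaled
    by the partial sums; for all of \<open>I\<close> the scale is 1.\<close>
  have "\<exists>\<gamma>. deforms c (\<lambda>t. (\<Sum>i\<in>F. \<rho> i t) *\<^sub>R h t) \<gamma>" if "F \<subseteq> I" for F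
    using finite_subset[OF that I(1)] that
  proof (induction F rule: finite_induct)
    case empty
    then show ?case using deforms_zero[OF c] by auto
  next
    case (insert i F)
    then obtain \<gamma> where \<gamma>: "deforms c (\<lambda>t. (\<Sum>i\<in>F. \<rho> i t) *\<^sub>R h t) \<gamma>"
      by blast
    have i: "i \<in> I" "i \<in> {0..1}" "c i \<in> points A"
      using insert.prems I(2) c by (auto simp: smooth_into_def)
    have "\<exists>\<gamma>'. deforms c (\<lambda>t. ((\<Sum>i\<in>F. \<rho> i t) + \<rho> i t) *\<^sub>R h t) \<gamma>'"
    proof (rule deforms_add[OF \<gamma> h \<rho>(1)[OF i(1)], of "cball i (\<delta> i) \<inter> {0..1}" "chart_at A (c i)"])
      show "compact (cball i (\<delta> i) \<inter> {0..1})"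
        by (intro compact_Int compact_cball compact_Icc)
      show "c ` (cball i (\<delta> i) \<inter> {0..1}) \<subseteq> fst (chart_at A (c i))"
        using \<delta>(2)[OF i(2)] by (auto simp: dist_real_def abs_minus_commute)
      show "\<rho> i t = 0" if "t \<in> {0..1} - cball i (\<delta> i) \<inter> {0..1}" for t
        using that by (intro \<rho>(2)[OF i(1)]) (auto simp: dist_real_def abs_minus_commute)
    qed (use i chart_at_in in auto)
    then show ?case
      using insert.hyps by (simp add: add.commute)
  qed
  from this[OF order_refl] obtain \<gamma> where "deforms c (\<lambda>t. (\<Sum>i\<in>I. \<rho> i t) *\<^sub>R h t) \<gamma>"
    by blast
  then have "deforms c h \<gamma>"
    using \<rho>(3) by (simp add: deforms_def)
  then show ?thesis by blast
qed

text \<open>A nonzero velocity is an open condition, and \<open>{0..1}\<close> is compact. So a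
  sufficiently short part of any deformation of an immersion consists of immersions.\<close>

lemma variation_exists:
  assumes c: "c \<in> Imm A" and h: "h \<in> T_Imm A c"
  shows "\<exists>\<gamma>. variation A c h \<gamma>"
proof -
  have c': "smooth_into A {0..1} c" and vel: "\<And>t. t \<in> {0..1} \<Longrightarrow> velocity A {0..1} c t \<noteq> 0"
    using c by (auto simp: Imm_def)
  obtain \<gamma> where "deforms c h \<gamma>"
    using deforms_exists[OF c' h] by blast
  then obtain \<epsilon> where \<epsilon>: "\<epsilon> > 0" "smooth_into A ({-\<epsilon><..<\<epsilon>} \<times> {0..1}) (\<lambda>(s, t). \<gamma> s t)"
    and \<gamma>0: "\<And>t. t \<in> {0..1} \<Longrightarrow> \<gamma> 0 t = c t"
    and \<gamma>h: "\<And>t. t \<in> {0..1} \<Longrightarrow> velocity A UNIV (\<lambda>s. \<gamma> s t) 0 = h t"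
    unfolding deforms_def by blast
  let ?R = "{-\<epsilon><..<\<epsilon>} \<times> {0..1::real}"
  let ?N = "{p\<in>?R. velocity A {0..1} (\<gamma> (fst p)) (snd p) \<noteq> 0}"
  have "\<exists>U. openin (top_of_set ?R) U \<and> (0, t) \<in> U \<and> U \<subseteq> ?N" if t: "t \<in> {0..1}" for t
  proof -
    have ct: "c t \<in> points A"
      using c' t by (auto simp: smooth_into_def)
    let ?ch = "chart_at A (c t)"
    note ch = chart_at_in[OF ct] mem_chart_at[OF ct]
    define Q where "Q = {p\<in>?R. \<gamma> (fst p) (snd p) \<in> fst ?ch}"
    note Q = partial_velocities(1,5)[OF \<epsilon>(2) ch(1), folded Q_def]
    define U where "U = Q \<inter> t_velocity ?ch \<gamma> -` (- {0})"
    have "openin (top_of_set Q) U"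
      unfolding U_def by (rule continuous_openin_preimage_gen[OF smooth_on_imp_continuous_on[OF Q(2)]]) auto
    then have "openin (top_of_set ?R) U"
      using Q(1) openin_trans by blast
    moreover have "velocity A {0..1} (\<gamma> 0) t = velocity A {0..1} c t"
      using velocity_cong[OF t] \<gamma>0 by blast
    then have "(0, t) \<in> U"
      using \<epsilon>(1) t ch \<gamma>0[OF t] vel[OF t] ct by (simp add: U_def Q_def t_velocity_def mdiff_center)
    \<comment> \<open>A linear map sends 0 to 0, so nonzero coordinates come from a nonzero
      velocity.\<close>
    moreover have "U \<subseteq> ?N"
      using linear_0[OF linear_mdiff_chart[OF ch(1)]] by (force simp: U_def Q_def t_velocity_def)
    ultimately show ?thesis by blast
  qed
  \<comment> \<open>The interior of \<open>?N\<close> relative to the strip; it is open and contains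
    \<open>{0} \<times> {0..1}\<close>, as the tube argument requires.\<close>
  moreover define W where "W = \<Union>{U. openin (top_of_set ?R) U \<and> U \<subseteq> ?N}"
  ultimately have "{0} \<times> {0..1} \<subseteq> W"
    by blast
  moreover have "openin (top_of_set ?R) W"
    unfolding W_def by (rule openin_Union) blast
  ultimately obtain \<delta> where \<delta>: "\<delta> > 0" "\<delta> \<le> \<epsilon>" "{-\<delta><..<\<delta>} \<times> {0..1} \<subseteq> W"
    using tube_at_0[OF _ \<epsilon>(1) compact_Icc order_refl] by blast
  have N: "{-\<delta><..<\<delta>} \<times> {0..1} \<subseteq> ?N"
    using \<delta>(3) unfolding W_def by blast
  have "\<gamma> s \<in> Imm A" if "s \<in> {-\<delta><..<\<delta>}" for s
  proof -
    have "velocity A {0..1} (\<gamma> s) t \<noteq> 0" if "t \<in> {0..1}" for t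
      using subsetD[OF N, of "(s, t)"] that \<open>s \<in> _\<close> by simp
    then show ?thesis
      using that \<delta>(2) smooth_into_slice(2)[OF \<epsilon>(2), of s] by (auto simp: Imm_def)
  qed
  moreover have "smooth_into A ({-\<delta><..<\<delta>} \<times> {0..1}) (\<lambda>(s, t). \<gamma> s t)"
    by (rule smooth_into_subset[OF \<epsilon>(2)]) (use \<delta>(2) in auto)
  ultimately show ?thesis
    using \<delta>(1) \<gamma>0 \<gamma>h unfolding variation_def by blast
qed

end

section \<open>The Levi-Civita connection in a chart\<close>

text \<open>The Christoffel symbols at \<open>p\<close> in the chart fixed for \<open>p\<close>, as
  a map of two vectors. The expansion over the basis makes it linear in \<open>v\<close> for any
  \<open>D\<close>.\<close>

definition christoffel ::
    "('a, 'e::euclidean_space) chart set \<Rightarrow> ('a \<Rightarrow> 'e \<Rightarrow> ('a \<Rightarrow> 'e) \<Rightarrow> 'e) \<Rightarrow> 'a \<Rightarrow> 'e \<Rightarrow> 'e \<Rightarrow> 'e" where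
  "christoffel A D p u v = (\<Sum>b\<in>Basis. (v \<bullet> b) *\<^sub>R D p u (coord_field A (chart_at A p) b))"

lemma linear_christoffel: "linear (christoffel A D p u)"
  unfolding christoffel_def
  by (rule linearI) (simp_all add: inner_add_left scaleR_add_left sum.distrib scaleR_sum_right)

lemma christoffel_Basis:
  assumes "b \<in> Basis"
  shows "christoffel A D p u b = D p u (coord_field A (chart_at A p) b)"
proof -
  have "christoffel A D p u b = (\<Sum>i\<in>Basis. if i = b then D p u (coord_field A (chart_at A p) i) else 0)"
    unfolding christoffel_def by (rule sum.cong) (use assms in \<open>auto simp: inner_Basis\<close>)
  with assms show ?thesis by simp
qed

text \<open>The maps \<open>L\<close> and \<open>M\<close> allow one formula to serve both for the
  metric coefficients, with coordinate fields at a point, and for terms that contain the Christoffel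
  map.\<close>

lemma bilinear_expand:
  fixes L M :: "'e::euclidean_space \<Rightarrow> 'f::euclidean_space"
  assumes "bilinear B" "linear L" "linear M"
  shows "B (L v) (M w) = (\<Sum>a\<in>Basis. \<Sum>b\<in>Basis. (v \<bullet> a) * (w \<bullet> b) * (B (L a) (M b) :: real))"
proof -
  have L: "L v = (\<Sum>a\<in>Basis. (v \<bullet> a) *\<^sub>R L a)"
    using linear_sum[OF assms(2), of "\<lambda>a. (v \<bullet> a) *\<^sub>R a" Basis] linear_cmul[OF assms(2)]
    by (simp add: euclidean_representation)
  have M: "M w = (\<Sum>a\<in>Basis. (w \<bullet> a) *\<^sub>R M a)"
    using linear_sum[OF assms(3), of "\<lambda>a. (w \<bullet> a) *\<^sub>R a" Basis] linear_cmul[OF assms(3)]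
    by (simp add: euclidean_representation)
  have "B (L v) (M w) = (\<Sum>a\<in>Basis. \<Sum>b\<in>Basis. B ((v \<bullet> a) *\<^sub>R L a) ((w \<bullet> b) *\<^sub>R M b))"
    unfolding L M bilinear_sum[OF assms(1)] by (simp add: sum.cartesian_product)
  then show ?thesis
    by (simp add: bilinear_lmul[OF assms(1)] bilinear_rmul[OF assms(1)] ac_simps)
qed

context smooth_manifold
begin

lemma openin_chart_domain: "ch \<in> A \<Longrightarrow> openin (atlas_topology A) (fst ch)"
  unfolding openin_atlas_topology[OF smooth_atlas]
  using open_overlap by (auto simp: points_def Int_commute)

text \<open>In another chart the coordinates of this field are the Jacobian applied to
  \<open>b\<close>, evaluated after a transition. The axioms on \<open>D\<close> and
  \<open>g\<close> thus apply to coordinate fields on the domain of a chart.\<close>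

lemma smooth_field_coord_field:
  assumes "ch \<in> A"
  shows "smooth_field A (fst ch) (coord_field A ch b)"
  unfolding smooth_field_def
proof
  fix ch' assume ch': "ch' \<in> A"
  let ?O = "snd ch' ` (fst ch \<inter> fst ch')"
  have "smooth_on (snd ch' ` (fst ch' \<inter> fst ch))
      (\<lambda>x. chart_diff ch ch' (chart_inv ch ((snd ch \<circ> chart_inv ch') x)) b)"
    by (rule smooth_on_compose[OF smooth_transition[OF ch' assms] smooth_chart_diff[OF assms ch']])
       (use ch' in \<open>auto simp: chart_inv_chart\<close>)
  then have "smooth_on ?O (\<lambda>x. chart_diff ch ch' (chart_inv ch ((snd ch \<circ> chart_inv ch') x)) b)"
    by (simp add: Int_commute)
  then show "smooth_on ?O (\<lambda>x. mdiff A (snd ch') (chart_inv ch' x) (coord_field A ch b (chart_inv ch' x)))"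
    by (rule smooth_on_cong) (use assms ch' in \<open>auto simp: chart_inv_chart mdiff_coord_field\<close>)
qed

lemma mdiff_coordinate:
  assumes "ch \<in> A" "q \<in> fst ch"
  shows "mdiff A (\<lambda>p. snd ch p \<bullet> i) q u = mdiff A (snd ch) q u \<bullet> i"
proof -
  let ?ch = "chart_at A q"
  have "((snd ch \<circ> chart_inv ?ch) has_derivative mdiff A (snd ch) q) (at (snd ?ch q))"
    unfolding mdiff_chart using assms chart_at_in mem_chart_at in_points by (intro chart_diff_works) auto
  then have "((\<lambda>x. (snd ch \<circ> chart_inv ?ch) x \<bullet> i) has_derivative (\<lambda>u. mdiff A (snd ch) q u \<bullet> i)) (at (snd ?ch q))"
    by (rule has_derivative_inner_left)
  from frechet_derivative_at[OF this] show ?thesis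
    unfolding mdiff_def[of A "\<lambda>p. snd ch p \<bullet> i"] by (simp add: o_def fun_eq_iff)
qed

lemma mdiff_locally_const:
  assumes "ch \<in> A" "p \<in> fst ch" "\<And>q. q \<in> fst ch \<Longrightarrow> f q = a"
  shows "mdiff A f p u = 0"
proof -
  let ?ch = "chart_at A p"
  have ch: "?ch \<in> A" "p \<in> fst ?ch"
    using assms chart_at_in mem_chart_at in_points by auto
  have "((f \<circ> chart_inv ?ch) has_derivative (\<lambda>u. 0)) (at (snd ?ch p))"
    by (rule has_derivative_transform_within_open[OF has_derivative_const open_overlap[OF ch(1) assms(1)]])
       (use assms ch in \<open>auto simp: chart_inv_chart\<close>)
  from frechet_derivative_at[OF this] show ?thesis
    unfolding mdiff_def by (metis)
qed

lemma smooth_fun_coordinate: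
  assumes "ch \<in> A"
  shows "smooth_fun A (fst ch) (\<lambda>p. snd ch p \<bullet> i)"
  unfolding smooth_fun_def
proof
  fix ch' assume "ch' \<in> A"
  then have "smooth_on (snd ch' ` (fst ch' \<inter> fst ch)) (\<lambda>x. (snd ch \<circ> chart_inv ch') x \<bullet> i)"
    by (intro smooth_on_inner smooth_transition assms)
  then show "smooth_on (snd ch' ` (fst ch \<inter> fst ch')) ((\<lambda>p. snd ch p \<bullet> i) \<circ> chart_inv ch')"
    by (simp add: o_def Int_commute)
qed

section \<open>Covariant derivatives and vertical parts in coordinates\<close>

text \<open>The frame in \<open>cov_deriv\<close> belongs to the chart fixed for \<open>x t\<close>,
  so at \<open>x t\<close> it is the standard basis and the sum reassembles into the coordinate
  derivative plus the Christoffel term.\<close>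

lemma cov_deriv_eq:
  fixes D :: "'a \<Rightarrow> 'e \<Rightarrow> ('a \<Rightarrow> 'e) \<Rightarrow> 'e"
  assumes "at t within S \<noteq> bot" "x t \<in> points A"
    and der: "((\<lambda>\<tau>. mdiff A (snd (chart_at A (x t))) (x \<tau>) (U \<tau>)) has_vector_derivative w) (at t within S)"
  shows "cov_deriv A D S x U t = w + christoffel A D (x t) (velocity A S x t) (U t)"
proof -
  have "vector_derivative (\<lambda>\<tau>. mdiff A (snd (chart_at A (x t))) (x \<tau>) (U \<tau>) \<bullet> b) (at t within S) = w \<bullet> b" for b
    by (rule vector_derivative_within[OF assms(1)])
       (rule bounded_linear.has_vector_derivative[OF bounded_linear_inner_left der])
  then show ?thesis
    using assms(2)
    by (simp add: cov_deriv_def Let_def coord_field_center mdiff_center christoffel_def sum.distrib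
        euclidean_representation)
qed

text \<open>In particular, neither part depends on the choice of the representing curve.\<close>

lemma hor_ver_part:
  fixes D :: "'a \<Rightarrow> 'e \<Rightarrow> ('a \<Rightarrow> 'e) \<Rightarrow> 'e" and a b v :: 'e
  assumes p: "p \<in> points A"
  defines "\<xi> \<equiv> coord_field (tangent_bundle A) (tangent_chart A (chart_at A p)) (a, b) (p, v)"
  shows "hor_part A (p, v) \<xi> = a" "ver_part A D (p, v) \<xi> = b + christoffel A D p a v"
proof -
  interpret TM: smooth_manifold "tangent_bundle A"
    by (rule smooth_manifold_tangent_bundle)
  let ?ch = "chart_at A p" and ?TC = "tangent_chart A (chart_at A p)"
  note ch = chart_at_in[OF p] mem_chart_at[OF p]
  define \<sigma> where "\<sigma> = representing_curve A (p, v) \<xi>"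
  have "(\<exists>\<epsilon>>0. smooth_into (tangent_bundle A) {-\<epsilon><..<\<epsilon>} \<sigma>) \<and> \<sigma> 0 = (p, v) \<and>
      velocity (tangent_bundle A) UNIV \<sigma> 0 = \<xi>"
    unfolding \<sigma>_def representing_curve_def
    by (rule someI_ex[OF TM.curve_with_velocity]) (use p in \<open>simp add: points_tangent_bundle\<close>)
  then obtain \<epsilon> where \<epsilon>: "\<epsilon> > 0" "smooth_into (tangent_bundle A) {-\<epsilon><..<\<epsilon>} \<sigma>"
    and \<sigma>: "\<sigma> 0 = (p, v)" "velocity (tangent_bundle A) UNIV \<sigma> 0 = \<xi>"
    by blast
  have TC: "?TC \<in> tangent_bundle A" "\<sigma> 0 \<in> fst ?TC"
    using ch \<sigma> by (auto simp: tangent_chart_in)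
  have "0 \<in> {-\<epsilon><..<\<epsilon>}" using \<epsilon>(1) by simp
  then have at_0: "at 0 within {-\<epsilon><..<\<epsilon>} = at 0"
    by (intro at_within_open open_greaterThanLessThan)
  have "(snd ?TC \<circ> \<sigma> has_vector_derivative
      mdiff (tangent_bundle A) (snd ?TC) (\<sigma> 0) (velocity (tangent_bundle A) {-\<epsilon><..<\<epsilon>} \<sigma> 0))
      (at 0 within {-\<epsilon><..<\<epsilon>})"
    by (rule TM.smooth_into_has_velocity[OF \<epsilon>(2) fat_open[OF open_greaterThanLessThan] TC(1) \<open>0 \<in> _\<close> TC(2)])
  \<comment> \<open>Every admissible curve has this same derivative in the chart, and both parts
    depend on nothing else besides the base vector.\<close>
  then have "(snd ?TC \<circ> \<sigma> has_vector_derivative (a, b)) (at 0)"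
    using \<sigma> TC unfolding at_0 TM.velocity_open[OF open_greaterThanLessThan \<open>0 \<in> _\<close>]
    by (simp add: \<xi>_def TM.mdiff_coord_field_same del: fst_tangent_chart snd_tangent_chart)
  moreover have "snd ?TC \<circ> \<sigma> = (\<lambda>s. (snd ?ch (fst (\<sigma> s)), mdiff A (snd ?ch) (fst (\<sigma> s)) (snd (\<sigma> s))))"
    by auto
  ultimately have der: "((\<lambda>s. (snd ?ch (fst (\<sigma> s)), mdiff A (snd ?ch) (fst (\<sigma> s)) (snd (\<sigma> s))))
      has_vector_derivative (a, b)) (at 0)"
    by simp
  have fst: "((\<lambda>s. snd ?ch (fst (\<sigma> s))) has_vector_derivative a) (at 0)"
    using bounded_linear.has_vector_derivative[OF bounded_linear_fst der] by simp
  have snd: "((\<lambda>s. mdiff A (snd ?ch) (fst (\<sigma> s)) (snd (\<sigma> s))) has_vector_derivative b) (at 0)"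
    using bounded_linear.has_vector_derivative[OF bounded_linear_snd der] by simp
  have vel: "velocity A UNIV (fst \<circ> \<sigma>) 0 = a"
    unfolding velocity_def using vector_derivative_at[OF fst] \<sigma>(1) by (simp add: o_def)
  then show "hor_part A (p, v) \<xi> = a"
    by (simp add: hor_part_def \<sigma>_def)
  have "cov_deriv A D UNIV (fst \<circ> \<sigma>) (snd \<circ> \<sigma>) 0 =
      b + christoffel A D ((fst \<circ> \<sigma>) 0) (velocity A UNIV (fst \<circ> \<sigma>) 0) ((snd \<circ> \<sigma>) 0)"
    by (rule cov_deriv_eq) (use snd p \<sigma>(1) in auto)
  then show "ver_part A D (p, v) \<xi> = b + christoffel A D p a v"
    using \<sigma>(1) by (simp add: ver_part_def \<sigma>_def[symmetric] vel)
qed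

end

section \<open>Consequences of vanishing torsion and metric compatibility\<close>

locale levi_civita_manifold = smooth_manifold A
  for A :: "('a, 'e::euclidean_space) chart set" +
  fixes g :: "'a \<Rightarrow> 'e \<Rightarrow> 'e \<Rightarrow> real" and D :: "'a \<Rightarrow> 'e \<Rightarrow> ('a \<Rightarrow> 'e) \<Rightarrow> 'e"
  assumes riemannian_metric: "riemannian_metric A g" and levi_civita: "levi_civita A g D"
begin

lemma bilinear_g: "p \<in> points A \<Longrightarrow> bilinear (g p)"
  and g_sym: "p \<in> points A \<Longrightarrow> g p u v = g p v u"
  and g_pos: "p \<in> points A \<Longrightarrow> u \<noteq> 0 \<Longrightarrow> 0 < g p u u"
  using riemannian_metric by (auto simp: riemannian_metric_def)

lemma linear_D_coord_field:
  assumes "ch \<in> A" "p \<in> fst ch"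
  shows "linear (\<lambda>u. D p u (coord_field A ch b))"
proof -
  have ac: "affine_connection A D" using levi_civita by (simp add: levi_civita_def)
  have "openin (atlas_topology A) (fst ch) \<and> smooth_field A (fst ch) (coord_field A ch b) \<and>
      smooth_field A (fst ch) (coord_field A ch b)"
    by (intro conjI openin_chart_domain smooth_field_coord_field assms(1))
  from ac[unfolded affine_connection_def, THEN spec, THEN spec, THEN spec, THEN mp, OF this,
      THEN conjunct1, THEN bspec, OF assms(2)]
  show ?thesis .
qed

text \<open>The torsion condition is tested on the coordinate functions. Their derivatives along
  coordinate fields are constant, so the bracket side vanishes, and each coordinate of the
  difference is 0.\<close>

lemma D_coord_field_sym:
  assumes p: "p \<in> points A"
  shows "D p a (coord_field A (chart_at A p) b) = D p b (coord_field A (chart_at A p) a)"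
proof -
  let ?ch = "chart_at A p" and ?d = "D p a (coord_field A (chart_at A p) b) - D p b (coord_field A (chart_at A p) a)"
  note ch = chart_at_in[OF p] mem_chart_at[OF p]
  have "?d \<bullet> i = 0" for i
  proof -
    let ?f = "\<lambda>q. snd ?ch q \<bullet> i"
    have tf: "torsion_free A D" using levi_civita by (simp add: levi_civita_def)
    have "mdiff A ?f p (D p (coord_field A ?ch a p) (coord_field A ?ch b) -
          D p (coord_field A ?ch b p) (coord_field A ?ch a)) =
        mdiff A (\<lambda>q. mdiff A ?f q (coord_field A ?ch b q)) p (coord_field A ?ch a p) -
        mdiff A (\<lambda>q. mdiff A ?f q (coord_field A ?ch a q)) p (coord_field A ?ch b p)"
      by (rule tf[unfolded torsion_free_def, rule_format, of "fst ?ch"])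
         (simp_all add: openin_chart_domain smooth_field_coord_field smooth_fun_coordinate ch)
    moreover have "mdiff A (\<lambda>q. mdiff A ?f q (coord_field A ?ch v q)) p u = 0" for u v
      by (rule mdiff_locally_const[OF ch, where a = "v \<bullet> i"])
         (simp add: mdiff_coordinate mdiff_coord_field_same ch)
    ultimately show ?thesis
      using p ch by (simp add: mdiff_coordinate coord_field_center mdiff_center)
  qed
  then have "?d = 0"
    by (metis euclidean_all_zero_iff)
  then show ?thesis by simp
qed

text \<open>Linearity of \<open>D\<close> in the direction allows both slots to be expanded in the
  basis, where the symmetry for coordinate fields applies.\<close>

lemma christoffel_sym:
  assumes p: "p \<in> points A"
  shows "christoffel A D p u v = christoffel A D p v u"
proof -
  let ?ch = "chart_at A p"
  note ch = chart_at_in[OF p] mem_chart_at[OF p]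
  have "christoffel A D p u v =
      (\<Sum>b\<in>Basis. (v \<bullet> b) *\<^sub>R (\<Sum>a\<in>Basis. (u \<bullet> a) *\<^sub>R D p a (coord_field A ?ch b)))" for u v
  proof -
    have "D p u (coord_field A ?ch b) = (\<Sum>a\<in>Basis. (u \<bullet> a) *\<^sub>R D p a (coord_field A ?ch b))" for b
      using linear_sum[OF linear_D_coord_field[OF ch], of "\<lambda>a. (u \<bullet> a) *\<^sub>R a" Basis]
        linear_cmul[OF linear_D_coord_field[OF ch]]
      by (simp add: euclidean_representation)
    then show ?thesis by (simp add: christoffel_def)
  qed
  note expand = this
  have "christoffel A D p u v = (\<Sum>b\<in>Basis. \<Sum>a\<in>Basis. ((v \<bullet> b) * (u \<bullet> a)) *\<^sub>R D p a (coord_field A ?ch b))"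
    by (simp add: expand scaleR_sum_right)
  also have "\<dots> = (\<Sum>a\<in>Basis. \<Sum>b\<in>Basis. ((u \<bullet> a) * (v \<bullet> b)) *\<^sub>R D p b (coord_field A ?ch a))"
    by (subst sum.swap) (simp add: D_coord_field_sym[OF p] mult.commute)
  also have "\<dots> = christoffel A D p v u"
    by (simp add: expand scaleR_sum_right)
  finally show ?thesis .
qed

text \<open>Compatibility fixes the value of \<open>mdiff\<close>, which is a total function;
  smoothness of the metric is what turns this value into an actual derivative.\<close>

lemma metric_coefficient_derivative:
  assumes p: "p \<in> points A"
  defines "ch \<equiv> chart_at A p"
  shows "((\<lambda>x. g (chart_inv ch x) (coord_field A ch a (chart_inv ch x)) (coord_field A ch b (chart_inv ch x)))
    has_derivative (\<lambda>u. g p (D p u (coord_field A ch a)) b + g p a (D p u (coord_field A ch b)))) (at (snd ch p))"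
proof -
  have ch: "ch \<in> A" "p \<in> fst ch"
    unfolding ch_def by (rule chart_at_in[OF p], rule mem_chart_at[OF p])
  let ?G = "\<lambda>q. g q (coord_field A ch a q) (coord_field A ch b q)"
  have "smooth_fun A (fst ch) ?G"
    using riemannian_metric openin_chart_domain[OF ch(1)] smooth_field_coord_field[OF ch(1)]
    unfolding riemannian_metric_def by blast
  then have "smooth_on (snd ch ` fst ch) (?G \<circ> chart_inv ch)"
    using ch(1) unfolding smooth_fun_def by fastforce
  from smooth_on_derivative(1)[OF this open_chart_image[OF ch(1)]]
  have "(?G \<circ> chart_inv ch) differentiable (at (snd ch p))"
    using ch(2) by blast
  then have "(?G \<circ> chart_inv ch has_derivative mdiff A ?G p) (at (snd ch p))"
    unfolding frechet_derivative_works by (simp add: mdiff_def[abs_def] ch_def)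
  moreover have "mdiff A ?G p = (\<lambda>u. g p (D p u (coord_field A ch a)) b + g p a (D p u (coord_field A ch b)))"
  proof
    fix u
    have "metric_compatible A g D" using levi_civita by (simp add: levi_civita_def)
    then have "mdiff A ?G p u = g p (D p u (coord_field A ch a)) (coord_field A ch b p) +
        g p (coord_field A ch a p) (D p u (coord_field A ch b))"
      using openin_chart_domain[OF ch(1)] smooth_field_coord_field[OF ch(1)] ch(2)
      unfolding metric_compatible_def by blast
    then show "mdiff A ?G p u = g p (D p u (coord_field A ch a)) b + g p a (D p u (coord_field A ch b))"
      using p by (simp add: ch_def coord_field_center)
  qed
  ultimately show ?thesis
    by (simp add: o_def)
qed

text \<open>Compatibility is assumed for fields on open sets, not along curves. Hence the squared
  length of the field with coordinates \<open>V\<close> is expanded in the coordinate frame and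
  differentiated with the product rule.\<close>

lemma metric_derivative_along_curve:
  fixes x :: "real \<Rightarrow> 'a"
  assumes p: "p \<in> points A" "x 0 = p"
  defines "ch \<equiv> chart_at A p"
  assumes x: "(snd ch \<circ> x has_vector_derivative u) (at 0)" "eventually (\<lambda>s. x s \<in> fst ch) (at 0)"
    and V: "(V has_vector_derivative w) (at 0)"
  shows "((\<lambda>s. g (x s) (coord_field A ch (V s) (x s)) (coord_field A ch (V s) (x s))) has_real_derivative
    2 * g p (w + christoffel A D p u (V 0)) (V 0)) (at 0)"
proof -
  have ch: "ch \<in> A" "p \<in> fst ch"
    unfolding ch_def by (rule chart_at_in[OF p(1)], rule mem_chart_at[OF p(1)])
  let ?E = "coord_field A ch"
  define G where "G a b q = g q (?E a q) (?E b q)" for a b q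
  define G' where "G' a b = g p (D p u (?E a)) b + g p a (D p u (?E b))" for a b
  have expand: "g q (?E v q) (?E v q) = (\<Sum>a\<in>Basis. \<Sum>b\<in>Basis. (v \<bullet> a) * (v \<bullet> b) * G a b q)"
    if "q \<in> fst ch" for q v
    unfolding G_def using that ch(1)
    by (intro bilinear_expand[where L = "\<lambda>v. ?E v q" and M = "\<lambda>v. ?E v q"] bilinear_g linear_coord_field in_points)
  have ev: "eventually (\<lambda>s. x s \<in> fst ch) (nhds 0)"
    using x(2) ch(2) p(2) by (simp add: eventually_nhds_conv_at)
  have G: "((\<lambda>s. G a b (x s)) has_real_derivative G' a b) (at 0)" for a b
  proof -
    have "((\<lambda>x. G a b (chart_inv ch x)) \<circ> (snd ch \<circ> x) has_vector_derivative G' a b) (at 0)"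
      unfolding G'_def
      by (rule vector_derivative_diff_chain_within[OF x(1)])
         (use metric_coefficient_derivative[OF p(1), of a b, folded ch_def] p(2) has_derivative_at_withinI
           in \<open>fastforce simp: G_def\<close>)
    moreover have "eventually (\<lambda>s. ((\<lambda>x. G a b (chart_inv ch x)) \<circ> (snd ch \<circ> x)) s = G a b (x s)) (nhds 0)"
      using ev by eventually_elim (simp add: chart_inv_chart[OF ch(1)])
    ultimately show ?thesis
      using DERIV_cong_ev[OF refl _ refl] by (metis has_real_derivative_iff_has_vector_derivative)
  qed
  have Va: "((\<lambda>s. V s \<bullet> a) has_real_derivative w \<bullet> a) (at 0)" for a
    using bounded_linear.has_vector_derivative[OF bounded_linear_inner_left V]
    by (simp add: has_real_derivative_iff_has_vector_derivative)
  have "((\<lambda>s. \<Sum>a\<in>Basis. \<Sum>b\<in>Basis. (V s \<bullet> a) * (V s \<bullet> b) * G a b (x s)) has_real_derivative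
      (\<Sum>a\<in>Basis. \<Sum>b\<in>Basis. ((w \<bullet> a) * (V 0 \<bullet> b) + (w \<bullet> b) * (V 0 \<bullet> a)) * G a b (x 0) +
         G' a b * ((V 0 \<bullet> a) * (V 0 \<bullet> b)))) (at 0)"
    by (intro DERIV_sum DERIV_mult Va G)
  note sum_der = this
  have "eventually (\<lambda>s. g (x s) (?E (V s) (x s)) (?E (V s) (x s)) =
      (\<Sum>a\<in>Basis. \<Sum>b\<in>Basis. (V s \<bullet> a) * (V s \<bullet> b) * G a b (x s))) (nhds 0)"
    using ev by eventually_elim (simp add: expand)
  from DERIV_cong_ev[OF refl this refl, THEN iffD2, OF sum_der] have "((\<lambda>s. g (x s) (?E (V s) (x s)) (?E (V s) (x s))) has_real_derivative
      (\<Sum>a\<in>Basis. \<Sum>b\<in>Basis. ((w \<bullet> a) * (V 0 \<bullet> b) + (w \<bullet> b) * (V 0 \<bullet> a)) * G a b (x 0) +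
         G' a b * ((V 0 \<bullet> a) * (V 0 \<bullet> b)))) (at 0)"
    .
  moreover have "(\<Sum>a\<in>Basis. \<Sum>b\<in>Basis. ((w \<bullet> a) * (V 0 \<bullet> b) + (w \<bullet> b) * (V 0 \<bullet> a)) * G a b (x 0) +
         G' a b * ((V 0 \<bullet> a) * (V 0 \<bullet> b))) = 2 * g p (w + christoffel A D p u (V 0)) (V 0)"
  proof -
    note B = bilinear_g[OF p(1)]
    let ?\<Gamma> = "christoffel A D p u"
    have e: "g p (L v) (M v') = (\<Sum>a\<in>Basis. \<Sum>b\<in>Basis. (v \<bullet> a) * (v' \<bullet> b) * g p (L a) (M b))"
      if "linear L" "linear M" for L M :: "'e \<Rightarrow> 'e" and v v'
      by (rule bilinear_expand[OF B that])
    have G0: "G a b (x 0) = g p a b" for a b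
      unfolding G_def p(2) using p(1) by (simp add: ch_def coord_field_center)
    have G'0: "G' a b = g p (?\<Gamma> a) b + g p a (?\<Gamma> b)" if "a \<in> Basis" "b \<in> Basis" for a b
      using that by (simp add: G'_def christoffel_Basis ch_def)
    \<comment> \<open>Two sums stem from differentiating the coordinates of the field, two from the
      metric coefficients; bilinearity and symmetry then pair them up.\<close>
    have "(\<Sum>a\<in>Basis. \<Sum>b\<in>Basis. ((w \<bullet> a) * (V 0 \<bullet> b) + (w \<bullet> b) * (V 0 \<bullet> a)) * G a b (x 0) +
         G' a b * ((V 0 \<bullet> a) * (V 0 \<bullet> b))) =
       (\<Sum>a\<in>Basis. \<Sum>b\<in>Basis. (w \<bullet> a) * (V 0 \<bullet> b) * g p a b) +
       (\<Sum>a\<in>Basis. \<Sum>b\<in>Basis. (V 0 \<bullet> a) * (w \<bullet> b) * g p a b) +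
       (\<Sum>a\<in>Basis. \<Sum>b\<in>Basis. (V 0 \<bullet> a) * (V 0 \<bullet> b) * g p (?\<Gamma> a) b) +
       (\<Sum>a\<in>Basis. \<Sum>b\<in>Basis. (V 0 \<bullet> a) * (V 0 \<bullet> b) * g p a (?\<Gamma> b))"
      unfolding sum.distrib[symmetric]
      by (intro sum.cong refl) (simp add: G0 G'0 algebra_simps)
    also have "\<dots> = g p w (V 0) + g p (V 0) w + g p (?\<Gamma> (V 0)) (V 0) + g p (V 0) (?\<Gamma> (V 0))"
      unfolding e[OF linear_ident linear_ident, of w "V 0"] e[OF linear_ident linear_ident, of "V 0" w]
        e[OF linear_christoffel linear_ident, of A D p u "V 0" "V 0"]
        e[OF linear_ident linear_christoffel, of "V 0" A D p u "V 0"] ..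
    also have "\<dots> = 2 * g p (w + ?\<Gamma> (V 0)) (V 0)"
      by (simp add: g_sym[OF p(1), of "V 0"] bilinear_ladd[OF B])
    finally show ?thesis .
  qed
  ultimately show ?thesis by simp
qed

section \<open>The derivative of the square root velocity function\<close>

text \<open>
  \<open>\<nabla>\<^sub>s \<partial>\<^sub>t = \<nabla>\<^sub>t \<partial>\<^sub>s\<close> by the symmetry of the connection and of the second derivatives.
\<close>

lemma cov_deriv_variation:
  assumes \<epsilon>: "\<epsilon> > 0" and \<gamma>: "smooth_into A ({-\<epsilon><..<\<epsilon>} \<times> {0..1}) (\<lambda>(s, t). \<gamma> s t)"
    and \<gamma>0: "\<And>t. t \<in> {0..1} \<Longrightarrow> \<gamma> 0 t = c t"
    and \<gamma>h: "\<And>t. t \<in> {0..1} \<Longrightarrow> velocity A UNIV (\<lambda>s. \<gamma> s t) 0 = h t"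
    and t: "t \<in> {0..1}"
  shows "\<exists>m. ((\<lambda>s. t_velocity (chart_at A (c t)) \<gamma> (s, t)) has_vector_derivative m) (at 0) \<and>
    cov_deriv A D {0..1} c h t = m + christoffel A D (c t) (h t) (velocity A {0..1} c t)"
proof -
  let ?ch = "chart_at A (c t)"
  have "\<gamma> 0 t \<in> points A"
    using smooth_into_slice(2)[OF \<gamma>, of 0] t \<epsilon> by (auto simp: smooth_into_def)
  then have p: "c t \<in> points A" using \<gamma>0[OF t] by simp
  note ch = chart_at_in[OF p] mem_chart_at[OF p]
  define Q where "Q = {p\<in>{-\<epsilon><..<\<epsilon>} \<times> {0..1}. \<gamma> (fst p) (snd p) \<in> fst ?ch}"
  note Q = partial_velocities[OF \<gamma> ch(1), folded Q_def]
  have t0: "(0, t) \<in> Q"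
    using \<epsilon> t ch(2) \<gamma>0[OF t] by (simp add: Q_def)
  obtain U' where U': "\<And>p. p \<in> Q \<Longrightarrow> (s_velocity ?ch \<gamma> has_derivative U' p) (at p within Q)"
      "continuous_on Q (\<lambda>p. U' p v)" for v
    using smooth_onD[OF Q(4), of "Suc 0"] by auto
  obtain V' where V': "\<And>p. p \<in> Q \<Longrightarrow> (t_velocity ?ch \<gamma> has_derivative V' p) (at p within Q)"
      "continuous_on Q (\<lambda>p. V' p v)" for v
    using smooth_onD[OF Q(5), of "Suc 0"] by auto
  \<comment> \<open>Both sides are second derivatives of the coordinate map of
    \<open>\<gamma>\<close>, whose first partial derivatives are the two velocities.\<close>
  have eq: "U' (0, t) (0, 1) = V' (0, t) (1, 0)"
    by (rule mixed_partials_eq[OF Q(1) open_greaterThanLessThan zero_less_one t0 Q(3)])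
       (use U' V' in simp_all)
  have "((\<lambda>s. t_velocity ?ch \<gamma> (s, t)) has_vector_derivative V' (0, t) (1, 0)) (at 0 within {-\<epsilon><..<\<epsilon>})"
    by (rule slice_has_vector_derivative(1)[OF Q(1) t0 V'(1)[OF t0]])
  then have "((\<lambda>s. t_velocity ?ch \<gamma> (s, t)) has_vector_derivative V' (0, t) (1, 0)) (at 0)"
    using \<epsilon> by (simp add: at_within_open[of 0 "{-\<epsilon><..<\<epsilon>}"])
  moreover have "((\<lambda>\<tau>. s_velocity ?ch \<gamma> (0, \<tau>)) has_vector_derivative U' (0, t) (0, 1)) (at t within {0..1})"
    by (rule slice_has_vector_derivative(2)[OF Q(1) t0 U'(1)[OF t0]])
  \<comment> \<open>At s = 0 the s-velocity is \<open>h\<close>, so the mixed derivative is the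
    coordinate part of the covariant derivative of \<open>h\<close>.\<close>
  then have "((\<lambda>\<tau>. mdiff A (snd ?ch) (c \<tau>) (h \<tau>)) has_vector_derivative U' (0, t) (0, 1)) (at t within {0..1})"
    by (rule has_vector_derivative_transform[OF t, rotated]) (simp add: s_velocity_def \<gamma>0 \<gamma>h)
  from cov_deriv_eq[OF fat_at_within_neq_bot[OF fat_interval[OF zero_less_one] t] p this]
  have "cov_deriv A D {0..1} c h t = U' (0, t) (0, 1) + christoffel A D (c t) (velocity A {0..1} c t) (h t)" .
  ultimately show ?thesis
    unfolding eq christoffel_sym[OF p, of "velocity A {0..1} c t"] by blast
qed

text \<open>Only the defining properties of the variation chosen in \<open>T_SRV\<close> are used.
  Its s-derivative is computed in the tangent chart over the chart of \<open>c t\<close>, where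
  \<open>hor_ver_part\<close> reads off both parts.\<close>

lemma T_SRV_eq:
  assumes c: "c \<in> Imm A" and h: "h \<in> T_Imm A c" and t: "t \<in> {0..1}"
  defines "v \<equiv> velocity A {0..1} c t" and "a \<equiv> cov_deriv A D {0..1} c h t"
  defines "n \<equiv> gnorm g (c t) v"
  shows "hor_part A (SRV A g c t) (T_SRV A g c h t) = h t"
    and "ver_part A D (SRV A g c t) (T_SRV A g c h t) =
      (1 / sqrt n) *\<^sub>R (a - (g (c t) a v / (2 * n\<^sup>2)) *\<^sub>R v)"
proof -
  interpret TM: smooth_manifold "tangent_bundle A"
    by (rule smooth_manifold_tangent_bundle)
  define \<gamma> where "\<gamma> = (SOME \<gamma>. variation A c h \<gamma>)"
  have "variation A c h \<gamma>"
    unfolding \<gamma>_def by (rule someI_ex[OF variation_exists[OF c h]])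
  then obtain \<epsilon> where \<epsilon>: "\<epsilon> > 0" and \<gamma>: "smooth_into A ({-\<epsilon><..<\<epsilon>} \<times> {0..1}) (\<lambda>(s, t). \<gamma> s t)"
    and \<gamma>0: "\<And>t. t \<in> {0..1} \<Longrightarrow> \<gamma> 0 t = c t"
    and \<gamma>h: "\<And>t. t \<in> {0..1} \<Longrightarrow> velocity A UNIV (\<lambda>s. \<gamma> s t) 0 = h t"
    unfolding variation_def by blast
  define p where "p = c t"
  have p: "p \<in> points A" and v: "v \<noteq> 0"
    using c t by (auto simp: Imm_def smooth_into_def p_def v_def)
  let ?ch = "chart_at A p" and ?TC = "tangent_chart A (chart_at A p)"
  note ch = chart_at_in[OF p] mem_chart_at[OF p]
  obtain m where m: "((\<lambda>s. t_velocity ?ch \<gamma> (s, t)) has_vector_derivative m) (at 0)"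
      "a = m + christoffel A D p (h t) v"
    using cov_deriv_variation[OF \<epsilon> \<gamma> \<gamma>0 \<gamma>h t] unfolding p_def v_def a_def by blast
  define vel where "vel s = velocity A {0..1} (\<gamma> s) t" for s
  define V where "V s = t_velocity ?ch \<gamma> (s, t)" for s
  define x where "x s = \<gamma> s t" for s
  have x0: "x 0 = p" using \<gamma>0[OF t] by (simp add: x_def p_def)
  have vel0: "vel 0 = v"
    unfolding vel_def v_def by (rule velocity_cong[OF t \<gamma>0])
  have V0: "V 0 = v"
    using vel0 \<gamma>0[OF t] p by (simp add: V_def t_velocity_def vel_def p_def mdiff_center)
  have x_smooth: "smooth_into A {-\<epsilon><..<\<epsilon>} x"
    unfolding x_def by (rule smooth_into_slice(1)[OF \<gamma> t])
  have "0 \<in> {-\<epsilon><..<\<epsilon>}" using \<epsilon> by simp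
  then have at_0: "at 0 within {-\<epsilon><..<\<epsilon>} = at 0"
    by (intro at_within_open open_greaterThanLessThan)
  have x_in: "eventually (\<lambda>s. x s \<in> fst ?ch) (at 0)"
    using smooth_into_ev[OF x_smooth ch(1) \<open>0 \<in> _\<close>] ch(2) x0 by (simp add: at_0)
  have "velocity A UNIV x 0 = h t"
    using \<gamma>h[OF t] by (simp add: x_def[abs_def])
  then have x_der: "(snd ?ch \<circ> x has_vector_derivative h t) (at 0)"
    using smooth_into_has_velocity[OF x_smooth fat_open[OF open_greaterThanLessThan] ch(1) \<open>0 \<in> _\<close>]
      ch(2) x0 p unfolding at_0 velocity_open[OF open_greaterThanLessThan \<open>0 \<in> _\<close>]
    by (simp add: mdiff_center)
  have vel_eq: "vel s = coord_field A ?ch (V s) (x s)" if "x s \<in> fst ?ch" for s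
    using that ch(1) by (simp add: V_def t_velocity_def vel_def x_def coord_field_mdiff)
  define N where "N s = g (x s) (coord_field A ?ch (V s) (x s)) (coord_field A ?ch (V s) (x s))" for s
  have N_der: "(N has_real_derivative 2 * g p a v) (at 0)"
    using metric_derivative_along_curve[OF p x0 x_der x_in m(1)[folded V_def]]
    unfolding N_def V0 m(2) .
  have N0: "N 0 = g p v v"
    using p by (simp add: N_def x0 V0 coord_field_center)
  then have "N 0 > 0" using g_pos[OF p v] by simp
  have n: "n = sqrt (N 0)" "n > 0" "n\<^sup>2 = N 0"
    using \<open>N 0 > 0\<close> by (simp_all add: n_def gnorm_def N0 p_def)
  \<comment> \<open>As \<open>N\<close> is the squared speed, this is its power -1/4. Since
    \<open>N\<close> has derivative \<open>2 * g p a v\<close>, the chain rule gives -1/4 times N to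
    the power -5/4 times that, which is the value below because \<open>N 0\<close> is the square of
    \<open>n\<close>.\<close>
  define \<phi> where "\<phi> s = 1 / sqrt (sqrt (N s))" for s
  have \<phi>_der: "(\<phi> has_real_derivative - (g p a v) / (2 * n\<^sup>2 * sqrt n)) (at 0)"
  proof -
    have "(\<phi> has_real_derivative
        - (inverse (sqrt (sqrt (N 0))) / 2 * (inverse (sqrt (N 0)) / 2 * (2 * g p a v))) / (sqrt (sqrt (N 0)))\<^sup>2) (at 0)"
      unfolding \<phi>_def using \<open>N 0 > 0\<close> N_der
      by (auto intro!: derivative_eq_intros simp: power2_eq_square)
    moreover have "(sqrt n)\<^sup>2 = n" using n(2) by simp
    moreover have "- (inverse r / 2 * (inverse n / 2 * (2 * y))) / n = - y / (2 * n\<^sup>2 * r)" if "r > 0" for r y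
      using n(2) that by (simp add: field_simps power2_eq_square)
    moreover have "sqrt n > 0" using n(2) by simp
    ultimately show ?thesis
      unfolding n(1)[symmetric] by simp
  qed
  \<comment> \<open>The derivative in the tangent chart: \<open>h t\<close> for the base point, and
    the product rule applied to \<open>\<phi> s *\<^sub>R V s\<close> for the fibre.\<close>
  define w where "w = (h t, \<phi> 0 *\<^sub>R m + (- (g p a v) / (2 * n\<^sup>2 * sqrt n)) *\<^sub>R v)"
  define \<sigma> where "\<sigma> s = SRV A g (\<gamma> s) t" for s
  have \<sigma>_eq: "\<sigma> s = (x s, \<phi> s *\<^sub>R vel s)" if "x s \<in> fst ?ch" for s
    using vel_eq[OF that] by (simp add: \<sigma>_def SRV_def gnorm_def x_def vel_def \<phi>_def N_def)
  have "((\<lambda>s. (snd ?ch (x s), \<phi> s *\<^sub>R V s)) has_vector_derivative w) (at 0)"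
  proof -
    have "((\<lambda>s. \<phi> s *\<^sub>R V s) has_vector_derivative \<phi> 0 *\<^sub>R m + (- (g p a v) / (2 * n\<^sup>2 * sqrt n)) *\<^sub>R V 0) (at 0)"
      using m(1) \<phi>_der unfolding V_def by (intro has_vector_derivative_scaleR)
    with x_der show ?thesis
      unfolding w_def V0 by (intro has_vector_derivative_Pair) (simp_all add: o_def)
  qed
  moreover have "eventually (\<lambda>s. (snd ?ch (x s), \<phi> s *\<^sub>R V s) = (snd ?TC \<circ> \<sigma>) s) (at 0)"
    using x_in
  proof eventually_elim
    case (elim s)
    then show ?case
      using linear_cmul[OF linear_mdiff_chart[OF ch(1) elim]] mdiff_coord_field_same[OF ch(1) elim]
      by (simp add: \<sigma>_eq vel_eq)
  qed
  moreover have x0_in: "x 0 \<in> fst ?ch" using ch(2) x0 by simp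
  then have "(snd ?ch (x 0), \<phi> 0 *\<^sub>R V 0) = (snd ?TC \<circ> \<sigma>) 0"
    using linear_cmul[OF linear_mdiff_chart[OF ch(1) x0_in]] mdiff_coord_field_same[OF ch(1) x0_in]
    by (simp add: \<sigma>_eq vel_eq)
  ultimately have "(snd ?TC \<circ> \<sigma> has_vector_derivative w) (at 0)"
    unfolding has_vector_derivative_def by (rule has_derivative_transform_eventually) simp
  moreover have "eventually (\<lambda>s. \<sigma> s \<in> fst ?TC) (at 0)"
    using x_in by eventually_elim (simp add: \<sigma>_eq)
  moreover have "\<sigma> 0 \<in> fst ?TC"
    using x0_in by (simp add: \<sigma>_eq)
  ultimately have "velocity (tangent_bundle A) UNIV \<sigma> 0 = coord_field (tangent_bundle A) ?TC w (\<sigma> 0)"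
    by (intro TM.velocity_eq tangent_chart_in ch) auto
  moreover have "\<sigma> 0 = (p, (1 / sqrt n) *\<^sub>R v)"
    using \<sigma>_eq[OF x0_in] x0 vel0 n(1) by (simp add: \<phi>_def)
  moreover have "SRV A g c t = (p, (1 / sqrt n) *\<^sub>R v)"
    by (simp add: SRV_def p_def v_def n_def)
  moreover have "T_SRV A g c h t = velocity (tangent_bundle A) UNIV \<sigma> 0"
    by (simp add: T_SRV_def Let_def \<gamma>_def[symmetric] \<sigma>_def[abs_def])
  ultimately have eqs: "SRV A g c t = (p, (1 / sqrt n) *\<^sub>R v)"
      "T_SRV A g c h t = coord_field (tangent_bundle A) ?TC w (p, (1 / sqrt n) *\<^sub>R v)"
    by simp_all
  show "hor_part A (SRV A g c t) (T_SRV A g c h t) = h t"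
    unfolding eqs w_def by (rule hor_ver_part(1)[OF p])
  have \<phi>0: "\<phi> 0 = 1 / sqrt n" by (simp add: \<phi>_def n(1))
  have "ver_part A D (SRV A g c t) (T_SRV A g c h t) =
      \<phi> 0 *\<^sub>R m + (- (g p a v) / (2 * n\<^sup>2 * sqrt n)) *\<^sub>R v + christoffel A D p (h t) ((1 / sqrt n) *\<^sub>R v)"
    unfolding eqs w_def by (rule hor_ver_part(2)[OF p])
  \<comment> \<open>The coordinate derivative \<open>m\<close> and the Christoffel term carry the
    same factor and recombine to the covariant derivative \<open>a\<close>.\<close>
  also have "\<dots> = (1 / sqrt n) *\<^sub>R (a - (g p a v / (2 * n\<^sup>2)) *\<^sub>R v)"
    unfolding m(2) \<phi>0 linear_cmul[OF linear_christoffel]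
    by (simp add: algebra_simps)
  finally show "ver_part A D (SRV A g c t) (T_SRV A g c h t) =
      (1 / sqrt n) *\<^sub>R (a - (g (c t) a v / (2 * n\<^sup>2)) *\<^sub>R v)"
    by (simp add: p_def)
qed

text \<open>With a and b the covariant derivatives, v the velocity and n its norm, both sides are
  (g(a,b) - 3/4 g(a,v) g(b,v) / n^2) / n. On the left 3/4 is 1 - 1/4, on the right it is 1/2 + 1/2 -
  1/4.\<close>

lemma integrand_eq:
  assumes c: "c \<in> Imm A" and t: "t \<in> {0..1}"
    and h: "h \<in> T_Imm A c" and k: "k \<in> T_Imm A c"
  shows "(g (c t) (nabla_l_N A g D c h t) (nabla_l_N A g D c k t)
      + 1/4 * g (c t) (nabla_l_T A g D c h t) (nabla_l_T A g D c k t)) * gnorm g (c t) (velocity A {0..1} c t) =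
    g (c t) (ver_part A D (SRV A g c t) (T_SRV A g c h t)) (ver_part A D (SRV A g c t) (T_SRV A g c k t))"
proof -
  define v where "v = velocity A {0..1} c t"
  define a where "a = cov_deriv A D {0..1} c h t"
  define b where "b = cov_deriv A D {0..1} c k t"
  define n where "n = gnorm g (c t) v"
  let ?g = "g (c t)"
  have p: "c t \<in> points A" and v: "v \<noteq> 0"
    using c t by (auto simp: Imm_def smooth_into_def v_def)
  note B = bilinear_g[OF p]
  note bil = bilinear_lmul[OF B] bilinear_rmul[OF B] bilinear_lsub[OF B] bilinear_rsub[OF B]
  have n: "n > 0" "?g v v = n * n"
    using g_pos[OF p v] by (simp_all add: n_def gnorm_def)
  have sym: "?g v b = ?g b v"
    by (rule g_sym[OF p])
  \<comment> \<open>One factor 1 / n is due to the arc length derivative, the other two to the two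
    unit tangents.\<close>
  have T: "nabla_l_T A g D c h t = (?g a v / (n * n * n)) *\<^sub>R v" "nabla_l_T A g D c k t = (?g b v / (n * n * n)) *\<^sub>R v"
    by (simp_all add: nabla_l_T_def nabla_l_def unit_tangent_def bil a_def b_def v_def n_def)
  have N: "nabla_l_N A g D c h t = (1 / n) *\<^sub>R a - (?g a v / (n * n * n)) *\<^sub>R v"
      "nabla_l_N A g D c k t = (1 / n) *\<^sub>R b - (?g b v / (n * n * n)) *\<^sub>R v"
    by (simp_all add: nabla_l_N_def T nabla_l_def a_def b_def v_def n_def)
  have ver: "ver_part A D (SRV A g c t) (T_SRV A g c h t) = (1 / sqrt n) *\<^sub>R (a - (?g a v / (2 * (n * n))) *\<^sub>R v)"
      "ver_part A D (SRV A g c t) (T_SRV A g c k t) = (1 / sqrt n) *\<^sub>R (b - (?g b v / (2 * (n * n))) *\<^sub>R v)"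
    using T_SRV_eq(2)[OF c h t] T_SRV_eq(2)[OF c k t]
    by (simp_all add: a_def b_def v_def n_def power2_eq_square)
  have s: "sqrt n * sqrt n = n" using n by simp
  let ?X = "a - (?g a v / (2 * (n * n))) *\<^sub>R v" and ?Y = "b - (?g b v / (2 * (n * n))) *\<^sub>R v"
  have "?g ((1 / sqrt n) *\<^sub>R ?X) ((1 / sqrt n) *\<^sub>R ?Y) = 1 / (sqrt n * sqrt n) * ?g ?X ?Y"
    by (simp add: bilinear_lmul[OF B] bilinear_rmul[OF B])
  also have "\<dots> = 1 / n * ?g ?X ?Y"
    unfolding s ..
  also have "\<dots> = (?g ((1 / n) *\<^sub>R a - (?g a v / (n * n * n)) *\<^sub>R v) ((1 / n) *\<^sub>R b - (?g b v / (n * n * n)) *\<^sub>R v)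
      + 1/4 * ?g ((?g a v / (n * n * n)) *\<^sub>R v) ((?g b v / (n * n * n)) *\<^sub>R v)) * n"
    using n(1) by (simp add: bil sym n(2) field_simps)
  finally show ?thesis
    unfolding N T ver v_def[symmetric] n_def[symmetric] by simp
qed

end

theorem proposition1:
  fixes A :: "('a, 'e::euclidean_space) chart set"
    and g :: "'a \<Rightarrow> 'e \<Rightarrow> 'e \<Rightarrow> real"
    and D :: "'a \<Rightarrow> 'e \<Rightarrow> ('a \<Rightarrow> 'e) \<Rightarrow> 'e"
  assumes "manifold A" and "riemannian_metric A g" and "levi_civita A g D"
  shows "\<forall>c \<in> Imm A. \<forall>h \<in> T_Imm A c. \<forall>k \<in> T_Imm A c.
           G A g D c h k = G_tilde A g D (SRV A g c) (T_SRV A g c h) (T_SRV A g c k)"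
proof (intro ballI)
  interpret levi_civita_manifold A g D
    by unfold_locales (use assms in \<open>auto simp: manifold_def\<close>)
  fix c h k assume ch: "c \<in> Imm A" "h \<in> T_Imm A c" "k \<in> T_Imm A c"
  have fst_SRV: "fst (SRV A g c t) = c t" for t
    by (simp add: SRV_def)
  have "integral {0..1} (\<lambda>t. (g (c t) (nabla_l_N A g D c h t) (nabla_l_N A g D c k t)
        + 1/4 * g (c t) (nabla_l_T A g D c h t) (nabla_l_T A g D c k t)) * gnorm g (c t) (velocity A {0..1} c t)) =
      integral {0..1} (\<lambda>t. g (c t) (ver_part A D (SRV A g c t) (T_SRV A g c h t))
        (ver_part A D (SRV A g c t) (T_SRV A g c k t)))"
    by (rule integral_cong) (rule integrand_eq[OF ch(1) _ ch(2,3)])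
  moreover have "hor_part A (SRV A g c 0) (T_SRV A g c h 0) = h 0"
      "hor_part A (SRV A g c 0) (T_SRV A g c k 0) = k 0"
    by (rule T_SRV_eq(1)[OF ch(1)]; use ch in simp)+
  ultimately show "G A g D c h k = G_tilde A g D (SRV A g c) (T_SRV A g c h) (T_SRV A g c k)"
    by (simp add: G_def G_tilde_def fst_SRV)
qed

end
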